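(* For a set $A\subseteq\omega$ the following conditions are equivalent. (1) There is an SDNR function $f_1\le_{wtt}A$. (2) For every recursive function $g$ there is a function $f_2\le_{wtt}A$ such that for all recursive functions $h$ with $|W_{h(n)}|<g(n)$ for all $n$, we have $f_2(n)\notin W_{h(n)}$ for all but finitely many $n$. (3) There is a function $f_3\le_{wtt}A$ such that for every partial recursive function $V$ taking inputs from $\{0,1\}^*$ and for almost all $n$, $f_3(n)\notin\{V(p): p\in\{0,1\}^*,\ |p|<n,\ V(p)\text{ is defined}\}$. (4) There is a function $f_4\le_{wtt}A$ with $C(f_4(n))\ge n$ for all $n$. (5) There is a DNR function $f_5\le_{wtt}A$. (6) $A$ is complex. Moreover, the conditions remain equivalent to these when $f_k\le_{wtt}A$ is replaced by $f_k\le_{tt}A$ in conditions (1)--(5).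
   Context: Fix an acceptable numbering $\varphi_0,\varphi_1,\dots$ of the partial recursive functions, and let $W_n$ be the $n$th recursively enumerable set. $C$ denotes plain Kolmogorov complexity with respect to a fixed universal machine on binary strings; natural numbers and binary strings are identified in a standard computable way. $A\upharpoonright y$ is the binary string $A(0)\ldots A(y-1)$. A set $A$ is complex if there is a recursive, nondecreasing, unbounded function $g:\omega\to\omega$ with $C(A\upharpoonright y)\ge g(y)$ for all $y$. A total function $f:\omega\to\omega$ is diagonally nonrecursive (DNR) if $f(x)\neq\varphi_x(x)$ for every $x$ with $\varphi_x(x)$ defined. It is strongly DNR (SDNR) if for all $x$ and all $y\le x$, $f(x)\ne\varphi_y(y)$ whenever $\varphi_y(y)$ is defined. $f\le_{wtt}A$ means $f$ is computed from $A$ by a Turing reduction whose use is bounded by a recursive function of the input; $f\le_{tt}A$ means $f$ is computed from $A$ by a Turing reduction that is total for every oracle. *)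

theory Defs
  imports Main "HOL-Library.Infinite_Set"
begin

section \<open>Partial recursive functions relative to an oracle\<close>

text \<open>
  Kleene's \<open>\<mu>\<close>-recursive functions with one extra initial function \<open>Oracle\<close>, which returns the
  answer (0 or 1) to a membership query.
\<close>

datatype recf =
    Zero
  | Succ
  | Proj nat
  | Oracle
  | Comp recf "recf list"
  | PrimRec recf recf
  | Mu recf

text \<open>
  \<open>evals \<sigma> e xs y\<close>: program \<open>e\<close> on input \<open>xs\<close> halts with output \<open>y\<close>.  The oracle \<open>\<sigma>\<close> is a partial
  function, and a query outside its domain makes the computation diverge.  As every
  subcomputation has to halt, halting relative to \<open>\<sigma>\<close> means that all queries made in the
  computation lie in \<open>dom \<sigma>\<close>.
\<close>

inductive evals :: "(nat \<rightharpoonup> bool) \<Rightarrow> recf \<Rightarrow> nat list \<Rightarrow> nat \<Rightarrow> bool" for \<sigma> where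
  Zero: "evals \<sigma> Zero xs 0"
| Succ: "evals \<sigma> Succ [x] (Suc x)"
| Proj: "i < length xs \<Longrightarrow> evals \<sigma> (Proj i) xs (xs ! i)"
| Oracle: "\<sigma> x = Some b \<Longrightarrow> evals \<sigma> Oracle [x] (of_bool b)"
| Comp: "list_all2 (\<lambda>g y. evals \<sigma> g xs y) gs ys \<Longrightarrow> evals \<sigma> f ys z
    \<Longrightarrow> evals \<sigma> (Comp f gs) xs z"
| PrimRec_0: "evals \<sigma> f xs y \<Longrightarrow> evals \<sigma> (PrimRec f g) (0 # xs) y"
| PrimRec_Suc: "evals \<sigma> (PrimRec f g) (n # xs) y \<Longrightarrow> evals \<sigma> g (n # y # xs) z
    \<Longrightarrow> evals \<sigma> (PrimRec f g) (Suc n # xs) z"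
| Mu: "evals \<sigma> f (n # xs) 0 \<Longrightarrow> (\<And>m. m < n \<Longrightarrow> \<exists>y>0. evals \<sigma> f (m # xs) y)
    \<Longrightarrow> evals \<sigma> (Mu f) xs n"

lemma evals_deterministic: "evals \<sigma> e xs y \<Longrightarrow> evals \<sigma> e xs z \<Longrightarrow> y = z"
proof (induction arbitrary: z rule: evals.induct)
  case (Zero xs)
  then show ?case by cases auto
next
  case (Succ x)
  then show ?case by cases auto
next
  case (Proj i xs)
  from Proj.prems show ?case by cases auto
next
  case (Oracle x b)
  from Oracle.prems Oracle.hyps show ?case by cases auto
next
  case (Comp xs gs ys f z z')
  from Comp.prems obtain ys' where
    ys': "list_all2 (\<lambda>g y. evals \<sigma> g xs y) gs ys'" "evals \<sigma> f ys' z'"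
    by cases auto
  have "ys = ys'"
    using Comp.IH(1) ys'(1) by (auto simp: list_all2_conv_all_nth intro!: nth_equalityI)
  with Comp.IH(2) ys'(2) show ?case by blast
next
  case (PrimRec_0 f xs y g)
  from PrimRec_0.prems have "evals \<sigma> f xs z" by cases auto
  then show ?case by (rule PrimRec_0.IH)
next
  case (PrimRec_Suc f g n xs y z z')
  from PrimRec_Suc.prems obtain y' where
    "evals \<sigma> (PrimRec f g) (n # xs) y'" "evals \<sigma> g (n # y' # xs) z'"
    by cases auto
  with PrimRec_Suc.IH show ?case by blast
next
  case (Mu f n xs z)
  from Mu.prems have z: "evals \<sigma> f (z # xs) 0" "\<And>m. m < z \<Longrightarrow> \<exists>y>0. evals \<sigma> f (m # xs) y"
    by (cases; blast)+
  have "\<not> z < n" using Mu.IH(2) z(1) by fastforce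
  moreover have "\<not> n < z" using Mu.IH(1) z(2) by fastforce
  ultimately show ?case by simp
qed

lemma evals_mono: "evals \<sigma> e xs y \<Longrightarrow> \<sigma> \<subseteq>\<^sub>m \<tau> \<Longrightarrow> evals \<tau> e xs y"
proof (induction rule: evals.induct)
  case (Oracle x b)
  then have "\<tau> x = Some b" by (metis domI map_le_def)
  then show ?case by (rule evals.Oracle)
next
  case (Comp xs gs ys f z)
  then have "list_all2 (\<lambda>g y. evals \<tau> g xs y) gs ys"
    by (auto simp: list_all2_conv_all_nth)
  with Comp show ?case by (blast intro: evals.Comp)
next
  case (PrimRec_Suc f g n xs y z)
  then show ?case by (metis evals.PrimRec_Suc)
next
  case (Mu f n xs)
  have "\<exists>y>0. evals \<tau> f (m # xs) y" if "m < n" for m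
    using Mu.IH(2)[OF that] Mu.prems by auto
  with Mu.IH(1)[OF Mu.prems] show ?case by (rule evals.Mu)
qed (simp_all add: evals.Zero evals.Succ evals.Proj evals.PrimRec_0)

text \<open>With the empty oracle the initial function \<open>Oracle\<close> is nowhere defined.\<close>

definition partial_recursive :: "(nat \<rightharpoonup> nat) \<Rightarrow> bool" where
  "partial_recursive \<psi> \<longleftrightarrow> (\<exists>e. \<forall>x y. \<psi> x = Some y \<longleftrightarrow> evals Map.empty e [x] y)"

definition partial_recursive2 :: "(nat \<Rightarrow> nat \<rightharpoonup> nat) \<Rightarrow> bool" where
  "partial_recursive2 \<psi> \<longleftrightarrow> (\<exists>e. \<forall>x y z. \<psi> x y = Some z \<longleftrightarrow> evals Map.empty e [x, y] z)"

definition recursive :: "(nat \<Rightarrow> nat) \<Rightarrow> bool" where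
  "recursive f \<longleftrightarrow> partial_recursive (\<lambda>x. Some (f x))"


section \<open>Acceptable numberings and recursively enumerable sets\<close>

text \<open>
  Acceptability in the sense of Rogers: the enumeration theorem and the s-m-n theorem hold.
  The second condition, for constant families \<open>\<psi>\<close>, also says that every partial recursive function
  has an index.
\<close>

definition acceptable_numbering :: "(nat \<Rightarrow> nat \<rightharpoonup> nat) \<Rightarrow> bool" where
  "acceptable_numbering \<phi> \<longleftrightarrow>
     partial_recursive2 \<phi> \<and>
     (\<forall>\<psi>. partial_recursive2 \<psi> \<longrightarrow> (\<exists>s. recursive s \<and> (\<forall>e. \<phi> (s e) = \<psi> e)))"

definition W :: "(nat \<Rightarrow> nat \<rightharpoonup> nat) \<Rightarrow> nat \<Rightarrow> nat set" where
  "W \<phi> n = dom (\<phi> n)"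


section \<open>Reducibilities\<close>

definition char_oracle :: "nat set \<Rightarrow> (nat \<rightharpoonup> bool)" where
  "char_oracle A = (\<lambda>x. Some (x \<in> A))"

text \<open>
  Restricting the oracle to \<open>{..<u x}\<close> forces all queries in the computation on input \<open>x\<close> to be
  below \<open>u x\<close>.  By \<open>evals_mono\<close> and \<open>evals_deterministic\<close> the unrestricted computation has the same result.
\<close>

definition wtt_reducible :: "(nat \<Rightarrow> nat) \<Rightarrow> nat set \<Rightarrow> bool"  (infix "\<le>wtt" 50) where
  "f \<le>wtt A \<longleftrightarrow>
     (\<exists>e u. recursive u \<and> (\<forall>x. evals (char_oracle A |` {..<u x}) e [x] (f x)))"

definition tt_reducible :: "(nat \<Rightarrow> nat) \<Rightarrow> nat set \<Rightarrow> bool"  (infix "\<le>tt" 50) where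
  "f \<le>tt A \<longleftrightarrow>
     (\<exists>e. (\<forall>X x. \<exists>y. evals (char_oracle X) e [x] y) \<and>
          (\<forall>x. evals (char_oracle A) e [x] (f x)))"


section \<open>Binary strings and plain Kolmogorov complexity\<close>

text \<open>
  The number of \<open>s\<close> is its position in the length-lexicographic order:
  the empty string, 0, 1, 00, 01, 10, 11, 000, ...
\<close>

definition nat_of_str :: "bool list \<Rightarrow> nat" where
  "nat_of_str s = foldl (\<lambda>n b. 2 * n + (if b then 2 else 1)) 0 s"

definition str_of_nat :: "nat \<Rightarrow> bool list" where
  "str_of_nat = inv nat_of_str"

lemma nat_of_str_simps [simp]:
  "nat_of_str [] = 0"
  "nat_of_str (s @ [b]) = 2 * nat_of_str s + (if b then 2 else 1)"
  by (simp_all add: nat_of_str_def)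

lemma bij_nat_of_str: "bij nat_of_str"
proof (rule bijI)
  show "inj nat_of_str"
  proof (rule injI)
    show "s = t" if "nat_of_str s = nat_of_str t" for s t
      using that
    proof (induction s arbitrary: t rule: rev_induct)
      case Nil
      then show ?case by (cases t rule: rev_cases) (auto split: if_splits)
    next
      case (snoc b s)
      then obtain c t' where t: "t = t' @ [c]"
        by (cases t rule: rev_cases) (auto split: if_splits)
      with snoc.prems have eq: "2 * nat_of_str s + (if b then 2 else 1) =
          2 * nat_of_str t' + (if c then 2 else 1)" by simp
      then have "b = c" by (auto split: if_splits; presburger)
      with eq snoc.IH[of t'] t show ?case by simp
    qed
  qed
  show "surj nat_of_str"
  proof -
    have "\<exists>s. nat_of_str s = n" for n
    proof (induction n rule: less_induct)
      case (less n)
      show ?case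
      proof (cases "n = 0")
        case True
        then show ?thesis by (metis nat_of_str_simps(1))
      next
        case False
        then have "(n - 1) div 2 < n" by linarith
        then obtain s where "nat_of_str s = (n - 1) div 2" using less by blast
        then have "nat_of_str (s @ [even n]) = n" using False by (auto elim!: oddE evenE)
        then show ?thesis by blast
      qed
    qed
    then show ?thesis by (metis surjI)
  qed
qed

lemma str_of_nat_inverse [simp]: "nat_of_str (str_of_nat n) = n"
  unfolding str_of_nat_def by (rule surj_f_inv_f[OF bij_is_surj[OF bij_nat_of_str]])

lemma nat_of_str_inverse [simp]: "str_of_nat (nat_of_str s) = s"
  unfolding str_of_nat_def by (rule inv_f_f[OF bij_is_inj[OF bij_nat_of_str]])

definition str_partial_recursive :: "(bool list \<rightharpoonup> nat) \<Rightarrow> bool" where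
  "str_partial_recursive V \<longleftrightarrow> partial_recursive (\<lambda>n. V (str_of_nat n))"

definition machine :: "(bool list \<rightharpoonup> bool list) \<Rightarrow> bool" where
  "machine M \<longleftrightarrow> str_partial_recursive (\<lambda>p. map_option nat_of_str (M p))"

text \<open>
  Additive optimality, as in the invariance theorem; it covers in particular every machine that
  simulates all others by prefixing their programs with a code of the machine.
\<close>

definition universal_machine :: "(bool list \<rightharpoonup> bool list) \<Rightarrow> bool" where
  "universal_machine U \<longleftrightarrow> machine U \<and>
     (\<forall>M. machine M \<longrightarrow>
       (\<exists>c. \<forall>p x. M p = Some x \<longrightarrow> (\<exists>q. U q = Some x \<and> length q \<le> length p + c)))"

definition plain_complexity :: "(bool list \<rightharpoonup> bool list) \<Rightarrow> bool list \<Rightarrow> nat" where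
  "plain_complexity U x = (LEAST k. \<exists>p. length p = k \<and> U p = Some x)"

text \<open>The set over which the minimum is taken is never empty for a universal machine.\<close>

lemma universal_machine_surj:
  assumes "universal_machine U"
  shows "\<exists>p. U p = Some x"
proof -
  have "Some y = Some z \<longleftrightarrow> evals Map.empty (Proj 0) [y] z" for y z
    using evals.Proj[of 0 "[y]" Map.empty] by (auto intro: evals_deterministic)
  then have "machine Some"
    unfolding machine_def str_partial_recursive_def partial_recursive_def by auto
  with assms show ?thesis unfolding universal_machine_def by blast
qed

definition initial_segment :: "nat set \<Rightarrow> nat \<Rightarrow> bool list"  (infix "\<restriction>" 80) where
  "A \<restriction> y = map (\<lambda>i. i \<in> A) [0..<y]"

definition complex_set :: "(bool list \<rightharpoonup> bool list) \<Rightarrow> nat set \<Rightarrow> bool" where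
  "complex_set U A \<longleftrightarrow>
     (\<exists>g. recursive g \<and> mono g \<and> (\<forall>k. \<exists>y. k \<le> g y) \<and>
          (\<forall>y. g y \<le> plain_complexity U (A \<restriction> y)))"


section \<open>Diagonally nonrecursive functions\<close>

definition DNR :: "(nat \<Rightarrow> nat \<rightharpoonup> nat) \<Rightarrow> (nat \<Rightarrow> nat) \<Rightarrow> bool" where
  "DNR \<phi> f \<longleftrightarrow> (\<forall>x. \<phi> x x \<noteq> Some (f x))"

definition SDNR :: "(nat \<Rightarrow> nat \<rightharpoonup> nat) \<Rightarrow> (nat \<Rightarrow> nat) \<Rightarrow> bool" where
  "SDNR \<phi> f \<longleftrightarrow> (\<forall>x. \<forall>y\<le>x. \<phi> y y \<noteq> Some (f x))"

end

theory Submission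
  imports Defs "HOL-Library.Nat_Bijection"
begin

text \<open>
  If \<open>A\<close> is complex, then \<open>f n = A \<restriction> y\<close> with \<open>y\<close> least such that \<open>n \<le> g y\<close> is truth-table
  reducible to \<open>A\<close> and satisfies \<open>n \<le> C (f n)\<close>.  Values computed from a number \<open>x\<close> have complexity
  at most \<open>x + O(1)\<close>, so suitable recursive reparametrisations of \<open>f\<close> satisfy all other conditions.

  Conversely, from a function satisfying any of the conditions a recursive reparametrisation makes a
  DNR function, and truth-table reductions are weak truth-table reductions by compactness.  If a
  DNR function \<open>f\<close> is computed from \<open>A\<close> with use \<open>u\<close>, let \<open>s p\<close> be an index of the function
  \<open>z \<mapsto> f z\<close> computed with the string \<open>U p\<close> as oracle.  A program \<open>p\<close> for \<open>A \<restriction> y\<close> with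
  \<open>y \<ge> u (s p)\<close> would give \<open>\<phi> (s p) (s p) = f (s p)\<close>.  Hence \<open>y < u (s p)\<close> whenever \<open>U p = A \<restriction> y\<close>,
  which bounds the complexity of \<open>A \<restriction> y\<close> from below.
\<close>

section \<open>Computable functions of a fixed arity\<close>

text \<open>Total oracle-free functions of a fixed arity; lists of other lengths are left
  unconstrained. The rules gathered in \<open>comp_intros\<close> prove computability by following
  the shape of a term.\<close>

definition computable :: "nat \<Rightarrow> (nat list \<Rightarrow> nat) \<Rightarrow> bool" where
  "computable k f \<longleftrightarrow> (\<exists>e. \<forall>xs. length xs = k \<longrightarrow> evals Map.empty e xs (f xs))"

text \<open>One program per entry, in the form in which \<open>Comp\<close> takes its
  arguments.\<close>

definition computable_list :: "nat \<Rightarrow> nat \<Rightarrow> (nat list \<Rightarrow> nat list) \<Rightarrow> bool" where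
  "computable_list k m F \<longleftrightarrow> (\<exists>es. length es = m \<and>
     (\<forall>xs. length xs = k \<longrightarrow> list_all2 (\<lambda>e y. evals Map.empty e xs y) es (F xs)))"

definition decidable :: "nat \<Rightarrow> (nat list \<Rightarrow> bool) \<Rightarrow> bool" where
  "decidable k P \<longleftrightarrow> computable k (\<lambda>xs. of_bool (P xs))"

named_theorems comp_intros

lemma computable_cong:
  assumes "\<And>xs. length xs = k \<Longrightarrow> f xs = g xs"
  shows "computable k f \<longleftrightarrow> computable k g"
  unfolding computable_def using assms by auto

lemma list_all2_Proj:
  "list_all2 (\<lambda>e y. evals \<sigma> e xs y) (map Proj [0..<length xs]) xs"
  by (auto simp: list_all2_conv_all_nth intro: evals.Proj)

text \<open>Besides substitution, this supplies weakening: taking \<open>tl\<close> for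
  \<open>F\<close> lets a function ignore an added first argument.\<close>

lemma computable_comp:
  assumes "computable m f" "computable_list k m F"
  shows "computable k (\<lambda>xs. f (F xs))"
proof -
  obtain e where e: "\<And>xs. length xs = m \<Longrightarrow> evals Map.empty e xs (f xs)"
    using assms(1) by (auto simp: computable_def)
  obtain es where es: "length es = m"
    "\<And>xs. length xs = k \<Longrightarrow> list_all2 (\<lambda>e y. evals Map.empty e xs y) es (F xs)"
    using assms(2) by (auto simp: computable_list_def)
  have "evals Map.empty (Comp e es) xs (f (F xs))" if "length xs = k" for xs
    using es e that by (metis evals.Comp list_all2_lengthD)
  then show ?thesis unfolding computable_def by blast
qed

lemma computable_list_Nil [comp_intros]: "computable_list k 0 (\<lambda>xs. [])"
  unfolding computable_list_def by auto

lemma computable_list_Cons [comp_intros]: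
  assumes "computable k f" "computable_list k m F"
  shows "computable_list k (Suc m) (\<lambda>xs. f xs # F xs)"
proof -
  obtain e where "\<And>xs. length xs = k \<Longrightarrow> evals Map.empty e xs (f xs)"
    using assms(1) by (auto simp: computable_def)
  moreover obtain es where "length es = m"
    "\<And>xs. length xs = k \<Longrightarrow> list_all2 (\<lambda>e y. evals Map.empty e xs y) es (F xs)"
    using assms(2) by (auto simp: computable_list_def)
  ultimately show ?thesis
    unfolding computable_list_def by (intro exI[of _ "e # es"]) auto
qed

lemma computable_list_id [comp_intros]: "computable_list k k (\<lambda>xs. xs)"
  unfolding computable_list_def
  by (intro exI[of _ "map Proj [0..<k]"]) (auto intro: list_all2_Proj)

lemma computable_list_tl [comp_intros]:
  assumes "computable_list k (Suc m) F"
  shows "computable_list k m (\<lambda>xs. tl (F xs))"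
proof -
  obtain es where es: "length es = Suc m"
    "\<And>xs. length xs = k \<Longrightarrow> list_all2 (\<lambda>e y. evals Map.empty e xs y) es (F xs)"
    using assms by (auto simp: computable_list_def)
  have "list_all2 (\<lambda>e y. evals Map.empty e xs y) (tl es) (tl (F xs))" if "length xs = k" for xs
    using es(2)[OF that] by (cases es; cases "F xs") auto
  with es(1) show ?thesis
    unfolding computable_list_def by (intro exI[of _ "tl es"]) auto
qed

lemma computable_hd [comp_intros]:
  assumes "computable_list k (Suc m) F"
  shows "computable k (\<lambda>xs. hd (F xs))"
proof -
  obtain es where es: "length es = Suc m"
    "\<And>xs. length xs = k \<Longrightarrow> list_all2 (\<lambda>e y. evals Map.empty e xs y) es (F xs)"
    using assms by (auto simp: computable_list_def)
  have "evals Map.empty (hd es) xs (hd (F xs))" if "length xs = k" for xs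
    using es(1) es(2)[OF that] by (cases es; cases "F xs") auto
  then show ?thesis unfolding computable_def by blast
qed

lemma computable_list_map:
  assumes "\<And>g. g \<in> set gs \<Longrightarrow> computable k (h g)"
  shows "computable_list k (length gs) (\<lambda>xs. map (\<lambda>g. h g xs) gs)"
  using assms by (induction gs) (auto intro!: comp_intros)

lemma computable_nth [comp_intros]: "i < k \<Longrightarrow> computable k (\<lambda>xs. xs ! i)"
  unfolding computable_def by (auto intro!: exI[of _ "Proj i"] evals.Proj)

lemma computable_Suc [comp_intros]:
  assumes "computable k f"
  shows "computable k (\<lambda>xs. Suc (f xs))"
proof -
  have "computable (Suc 0) (\<lambda>xs. Suc (hd xs))"
    unfolding computable_def
    by (intro exI[of _ Succ]) (auto simp: length_Suc_conv intro: evals.Succ)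
  then have "computable k (\<lambda>xs. Suc (hd [f xs]))"
    by (rule computable_comp) (rule comp_intros assms)+
  then show ?thesis by simp
qed

lemma computable_const [comp_intros]: "computable k (\<lambda>xs. c)"
proof (induction c)
  case 0
  show ?case unfolding computable_def by (auto intro!: exI[of _ Zero] evals.Zero)
next
  case (Suc c)
  then show ?case by (rule computable_Suc)
qed

text \<open>\<open>PrimRec\<close> passes the counter and the previous value in front of the
  parameters, hence the \<open>hd\<close>/\<open>tl\<close> form of the step. Characterising
  \<open>F\<close> by recursion equations allows closed expressions such as \<open>f xs + n\<close>
  in its place.\<close>

lemma computable_rec:
  assumes "computable k a" "computable k b"
    and "computable (Suc (Suc k)) (\<lambda>ys. h (hd ys) (hd (tl ys)) (tl (tl ys)))"
    and F: "\<And>xs. F 0 xs = a xs" "\<And>n xs. F (Suc n) xs = h n (F n xs) xs"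
  shows "computable k (\<lambda>xs. F (b xs) xs)"
proof -
  obtain ea where ea: "\<And>xs. length xs = k \<Longrightarrow> evals Map.empty ea xs (a xs)"
    using assms(1) by (auto simp: computable_def)
  obtain eh where eh: "\<And>ys. length ys = Suc (Suc k) \<Longrightarrow>
      evals Map.empty eh ys (h (hd ys) (hd (tl ys)) (tl (tl ys)))"
    using assms(3) by (auto simp: computable_def)
  have "evals Map.empty (PrimRec ea eh) (n # xs) (F n xs)" if "length xs = k" for n xs
  proof (induction n)
    case (Suc n)
    then show ?case
      using eh[of "n # F n xs # xs"] that by (auto simp: F intro: evals.PrimRec_Suc)
  qed (simp add: F evals.PrimRec_0 ea that)
  then have "computable (Suc k) (\<lambda>ys. F (hd ys) (tl ys))"
    unfolding computable_def by (intro exI[of _ "PrimRec ea eh"]) (auto simp: length_Suc_conv)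
  then have "computable k (\<lambda>xs. F (hd (b xs # xs)) (tl (b xs # xs)))"
    by (rule computable_comp) (rule comp_intros assms(2))+
  then show ?thesis by simp
qed

section \<open>Arithmetic and bounded sums\<close>

lemma computable_add [comp_intros]:
  assumes "computable k f" "computable k g"
  shows "computable k (\<lambda>xs. f xs + g xs)"
  by (rule computable_rec[OF assms, where F = "\<lambda>n xs. f xs + n" and h = "\<lambda>i r xs. Suc r"])
    (rule comp_intros | simp)+

lemma computable_diff [comp_intros]:
  assumes "computable k f" "computable k g"
  shows "computable k (\<lambda>xs. f xs - g xs)"
proof -
  \<comment> \<open>The predecessor arises from a recursion that returns its counter; truncated
    subtraction then iterates it.\<close>
  have pred: "computable m (\<lambda>xs. f xs - 1)" if "computable m f" for m f
    by (rule computable_rec[OF computable_const[of _ 0] that,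
          where F = "\<lambda>n xs. n - 1" and h = "\<lambda>i r xs. i"])
      (rule comp_intros | simp)+
  show ?thesis
    by (rule computable_rec[OF assms, where F = "\<lambda>n xs. f xs - n" and h = "\<lambda>i r xs. r - 1"])
      (rule comp_intros pred | simp)+
qed

lemma computable_mult [comp_intros]:
  assumes "computable k f" "computable k g"
  shows "computable k (\<lambda>xs. f xs * g xs)"
  by (rule computable_rec[OF computable_const[of _ 0] assms(2),
        where F = "\<lambda>n xs. f xs * n" and h = "\<lambda>i r xs. r + f xs"])
    (rule comp_intros computable_comp[OF assms(1)] | simp)+

lemma computable_power [comp_intros]:
  assumes "computable k f"
  shows "computable k (\<lambda>xs. c ^ f xs)"
  by (rule computable_rec[OF computable_const[of _ 1] assms,
        where F = "\<lambda>n xs. c ^ n" and h = "\<lambda>i r xs. c * r"])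
    (rule comp_intros | simp)+

text \<open>Bounded sums carry all bounded operations below: quantifiers count counterexamples, and
  division, string length and decoding count or select by a sum.\<close>

lemma computable_sum [comp_intros]:
  assumes "computable (Suc k) (\<lambda>ys. f (hd ys) (tl ys))" "computable k b"
  shows "computable k (\<lambda>xs. \<Sum>i<b xs. f i xs)"
proof -
  have "computable (Suc (Suc k)) (\<lambda>ys. f (hd (hd ys # tl (tl ys))) (tl (hd ys # tl (tl ys))))"
    by (rule computable_comp[OF assms(1)]) (rule comp_intros)+
  then have "computable (Suc (Suc k)) (\<lambda>ys. f (hd ys) (tl (tl ys)))" by simp
  then show ?thesis
    by (intro computable_rec[OF computable_const[of _ 0] assms(2),
          where F = "\<lambda>n xs. \<Sum>i<n. f i xs" and h = "\<lambda>i r xs. r + f i xs"])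
      (rule comp_intros | simp)+
qed

section \<open>Decidable predicates and bounded quantifiers\<close>

lemma decidable_not [comp_intros]:
  assumes "decidable k P"
  shows "decidable k (\<lambda>xs. \<not> P xs)"
proof -
  have "computable k (\<lambda>xs. 1 - of_bool (P xs))"
    by (rule comp_intros assms[unfolded decidable_def])+
  moreover have "1 - of_bool b = (of_bool (\<not> b) :: nat)" for b by simp
  ultimately show ?thesis unfolding decidable_def by simp
qed

lemma decidable_conj [comp_intros]:
  assumes "decidable k P" "decidable k Q"
  shows "decidable k (\<lambda>xs. P xs \<and> Q xs)"
  unfolding decidable_def of_bool_conj
  by (rule comp_intros assms[unfolded decidable_def])+

lemma decidable_disj [comp_intros]:
  assumes "decidable k P" "decidable k Q"
  shows "decidable k (\<lambda>xs. P xs \<or> Q xs)"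
proof -
  have "decidable k (\<lambda>xs. \<not> (\<not> P xs \<and> \<not> Q xs))" by (rule comp_intros assms)+
  then show ?thesis by simp
qed

lemma decidable_le [comp_intros]:
  assumes "computable k f" "computable k g"
  shows "decidable k (\<lambda>xs. f xs \<le> g xs)"
proof -
  have "of_bool (x \<le> y) = 1 - (x - y)" for x y :: nat by auto
  with assms show ?thesis unfolding decidable_def by (auto intro: comp_intros)
qed

lemma decidable_less [comp_intros]:
  "computable k f \<Longrightarrow> computable k g \<Longrightarrow> decidable k (\<lambda>xs. f xs < g xs)"
  unfolding Suc_le_eq[symmetric] by (rule comp_intros | assumption)+

lemma decidable_eq [comp_intros]:
  "computable k f \<Longrightarrow> computable k g \<Longrightarrow> decidable k (\<lambda>xs. f xs = g xs)"
  unfolding eq_iff by (rule comp_intros | assumption)+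

lemma decidable_all [comp_intros]:
  assumes "decidable (Suc k) (\<lambda>ys. P (hd ys) (tl ys))" "computable k b"
  shows "decidable k (\<lambda>xs. \<forall>i<b xs. P i xs)"
proof -
  have "decidable k (\<lambda>xs. (\<Sum>i<b xs. of_bool (\<not> P i xs)) = (0::nat))"
    by (rule comp_intros decidable_not[OF assms(1), unfolded decidable_def] assms(2))+
  moreover have "(\<Sum>i<b xs. of_bool (\<not> P i xs)) = (0::nat) \<longleftrightarrow> (\<forall>i<b xs. P i xs)" for xs
    by auto
  ultimately show ?thesis by simp
qed

lemma decidable_ex [comp_intros]:
  assumes "decidable (Suc k) (\<lambda>ys. P (hd ys) (tl ys))" "computable k b"
  shows "decidable k (\<lambda>xs. \<exists>i<b xs. P i xs)"
proof -
  have "decidable k (\<lambda>xs. \<not> (\<forall>i<b xs. \<not> P i xs))" by (rule comp_intros assms)+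
  then show ?thesis by simp
qed

lemma decidable_const [comp_intros]: "decidable k (\<lambda>xs. c)"
  unfolding decidable_def by (rule computable_const)

lemma computable_of_bool [comp_intros]: "decidable k P \<Longrightarrow> computable k (\<lambda>xs. of_bool (P xs))"
  by (simp add: decidable_def)

lemma computable_if [comp_intros]:
  assumes "decidable k P" "computable k f" "computable k g"
  shows "computable k (\<lambda>xs. if P xs then f xs else g xs)"
proof -
  have "computable k (\<lambda>xs. of_bool (P xs) * f xs + of_bool (\<not> P xs) * g xs)"
    by (rule comp_intros assms)+
  moreover have "(\<lambda>xs. of_bool (P xs) * f xs + of_bool (\<not> P xs) * g xs)
      = (\<lambda>xs. if P xs then f xs else g xs)" by auto
  ultimately show ?thesis by simp
qed

text \<open>The list is fixed in advance, so this is a finite disjunction; in \<open>Comp\<close> it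
  tests whether some argument has not yet halted.\<close>

lemma decidable_bex_list:
  assumes "\<And>g. g \<in> set gs \<Longrightarrow> decidable k (P g)"
  shows "decidable k (\<lambda>xs. \<exists>g\<in>set gs. P g xs)"
  using assms by (induction gs) (auto intro!: comp_intros)

lemma computable_div [comp_intros]:
  assumes "computable k f" "computable k g"
  shows "computable k (\<lambda>xs. f xs div g xs)"
proof -
  \<comment> \<open>The quotient counts the positive multiples of \<open>y\<close> up to
    \<open>x\<close>. The conjunct \<open>0 < y\<close> yields the value 0 for division by
    zero.\<close>
  have "x div y = (\<Sum>q<x. of_bool (0 < y \<and> Suc q * y \<le> x))" for x y :: nat
  proof (cases "y = 0")
    case False
    then have "Suc q * y \<le> x \<longleftrightarrow> q < x div y" for q
      by (simp add: less_eq_div_iff_mult_less_eq[symmetric] Suc_le_eq[symmetric] del: mult_Suc)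
    moreover have "x div y \<le> x" by simp
    ultimately have "{q. q < x \<and> Suc q * y \<le> x} = {..<x div y}"
      by (auto simp del: mult_Suc intro: order.strict_trans2)
    then show ?thesis using False by (simp add: Int_def lessThan_def del: mult_Suc)
  qed simp
  moreover have "computable k (\<lambda>xs. \<Sum>q<f xs. of_bool (0 < g xs \<and> Suc q * g xs \<le> f xs))"
    by (rule comp_intros assms computable_comp[OF assms(1)] computable_comp[OF assms(2)])+
  ultimately show ?thesis by simp
qed

text \<open>The source of partial functions: the program finds the least witness with
  \<open>Mu\<close> and diverges exactly when there is none.\<close>

lemma computable_search:
  assumes P: "decidable (Suc k) (\<lambda>ys. P (hd ys) (tl ys))"
    and f: "computable (Suc k) (\<lambda>ys. f (hd ys) (tl ys))"
  obtains e where "\<And>xs y. length xs = k \<Longrightarrow>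
    evals Map.empty e xs y \<longleftrightarrow> (\<exists>t. P t xs) \<and> y = f (LEAST t. P t xs) xs"
proof -
  obtain p where "\<And>ys. length ys = Suc k \<Longrightarrow>
      evals Map.empty p ys (of_bool (\<not> P (hd ys) (tl ys)))"
    using decidable_not[OF P] by (auto simp: decidable_def computable_def)
  from this[of "t # xs" for t xs]
  have p: "evals Map.empty p (t # xs) (of_bool (\<not> P t xs))" if "length xs = k" for t xs
    using that by simp
  obtain q where "\<And>ys. length ys = Suc k \<Longrightarrow> evals Map.empty q ys (f (hd ys) (tl ys))"
    using f by (auto simp: computable_def)
  from this[of "t # xs" for t xs]
  have q: "evals Map.empty q (t # xs) (f t xs)" if "length xs = k" for t xs
    using that by simp
  \<comment> \<open>\<open>Mu\<close> looks for a zero, so \<open>p\<close> computes the negation of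
    \<open>P\<close>; the projections hand the original input on to \<open>q\<close>.\<close>
  define e where "e = Comp q (Mu p # map Proj [0..<k])"
  have ex: "evals Map.empty e xs (f (LEAST t. P t xs) xs)" if k: "length xs = k" and "P t xs" for xs t
  proof -
    define l where "l = (LEAST t. P t xs)"
    have "P l xs" "\<And>s. s < l \<Longrightarrow> \<not> P s xs"
      unfolding l_def using that(2) by (auto intro: LeastI dest: not_less_Least)
    then have "evals Map.empty (Mu p) xs l"
      using p[OF k] by (intro evals.Mu) (metis of_bool_eq(1), metis of_bool_eq(2) zero_less_one)
    with q[OF k] list_all2_Proj[of Map.empty xs] k show ?thesis
      unfolding e_def l_def[symmetric] by (auto intro!: evals.Comp)
  qed
  have "\<exists>t. P t xs" if k: "length xs = k" and "evals Map.empty e xs y" for xs y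
  proof -
    from that(2) obtain t where "evals Map.empty (Mu p) xs t"
      unfolding e_def by cases (auto simp: list_all2_Cons1)
    then have "evals Map.empty p (t # xs) 0" by cases
    with p[OF k] have "of_bool (\<not> P t xs) = (0::nat)" by (blast intro: evals_deterministic)
    then show ?thesis by auto
  qed
  with ex that[of e] show thesis by (metis evals_deterministic)
qed

lemma computable_Least:
  assumes "decidable (Suc k) (\<lambda>ys. P (hd ys) (tl ys))"
    and "\<And>xs. length xs = k \<Longrightarrow> \<exists>t. P t xs"
  shows "computable k (\<lambda>xs. LEAST t. P t xs)"
proof -
  obtain e where "\<And>xs y. length xs = k \<Longrightarrow>
    evals Map.empty e xs y \<longleftrightarrow> (\<exists>t. P t xs) \<and> y = (LEAST t. P t xs)"
    by (rule computable_search[OF assms(1), of "\<lambda>t xs. t"]) (auto intro: comp_intros)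
  with assms(2) show ?thesis unfolding computable_def by blast
qed

lemma recursive_iff: "recursive f \<longleftrightarrow> (\<exists>e. \<forall>x. evals Map.empty e [x] (f x))"
  unfolding recursive_def partial_recursive_def by (metis evals_deterministic option.inject)

lemma recursive_iff_computable: "recursive f \<longleftrightarrow> computable (Suc 0) (\<lambda>xs. f (hd xs))"
proof -
  have "(\<forall>x. evals Map.empty e [x] (f x)) \<longleftrightarrow>
      (\<forall>xs. length xs = Suc 0 \<longrightarrow> evals Map.empty e xs (f (hd xs)))" for e
    by (auto simp: length_Suc_conv)
  then show ?thesis unfolding recursive_iff computable_def by simp
qed

lemma computable_recursive:
  assumes "recursive f" "computable k g"
  shows "computable k (\<lambda>xs. f (g xs))"
proof -
  have "computable k (\<lambda>xs. f (hd [g xs]))"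
    by (rule computable_comp[OF assms(1)[unfolded recursive_iff_computable]])
      (rule comp_intros assms(2))+
  then show ?thesis by simp
qed

section \<open>Step-bounded evaluation\<close>

text \<open>
  The result is shifted by one: 0 means that the computation has not halted, \<open>Suc y\<close> that it has
  halted with output \<open>y\<close>.  Only the searches of \<open>Mu\<close> have to be bounded.
\<close>

fun stage :: "(nat \<rightharpoonup> bool) \<Rightarrow> nat \<Rightarrow> recf \<Rightarrow> nat list \<Rightarrow> nat" where
  "stage \<sigma> t Zero xs = 1"
| "stage \<sigma> t Succ xs = (if length xs = 1 then Suc (Suc (hd xs)) else 0)"
| "stage \<sigma> t (Proj i) xs = (if i < length xs then Suc (xs ! i) else 0)"
| "stage \<sigma> t Oracle xs =
     (if length xs = 1 then case \<sigma> (hd xs) of None \<Rightarrow> 0 | Some b \<Rightarrow> Suc (of_bool b) else 0)"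
| "stage \<sigma> t (Comp f gs) xs = (let ys = map (\<lambda>g. stage \<sigma> t g xs) gs in
     if 0 \<in> set ys then 0 else stage \<sigma> t f (map (\<lambda>y. y - 1) ys))"
| "stage \<sigma> t (PrimRec f g) xs = (case xs of [] \<Rightarrow> 0 | n # zs \<Rightarrow>
     rec_nat (stage \<sigma> t f zs) (\<lambda>i r. if r = 0 then 0 else stage \<sigma> t g (i # (r - 1) # zs)) n)"
| "stage \<sigma> t (Mu f) xs =
     (\<Sum>n<t. if stage \<sigma> t f (n # xs) = 1 \<and> (\<forall>m<n. 1 < stage \<sigma> t f (m # xs)) then Suc n else 0)"

text \<open>A nonzero value certifies a finished computation for any step bound. Only
  \<open>Mu\<close> is delicate: its sum must have a single nonzero summand.\<close>

lemma stage_sound: "stage \<sigma> t e xs = Suc y \<Longrightarrow> evals \<sigma> e xs y"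
proof (induction e arbitrary: xs y)
  case Zero
  then show ?case by (auto intro: evals.Zero)
next
  case Succ
  then show ?case by (auto simp: length_Suc_conv intro: evals.Succ split: if_splits)
next
  case (Proj i)
  then show ?case by (auto intro: evals.Proj split: if_splits)
next
  case Oracle
  then show ?case
    by (auto simp: length_Suc_conv intro: evals.Oracle split: if_splits option.splits)
next
  case (Comp f gs)
  let ?ys = "map (\<lambda>g. stage \<sigma> t g xs - 1) gs"
  have nz: "stage \<sigma> t g xs \<noteq> 0" if "g \<in> set gs" for g
    using Comp.prems that by (force simp: Let_def split: if_splits)
  have "stage \<sigma> t f ?ys = Suc y"
    using Comp.prems by (auto simp: Let_def comp_def split: if_splits)
  then have "evals \<sigma> f ?ys y" by (rule Comp.IH(1))
  moreover have "evals \<sigma> g xs (stage \<sigma> t g xs - 1)" if "g \<in> set gs" for g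
    using Comp.IH(2)[OF that] nz[OF that] by simp
  then have "list_all2 (\<lambda>g y. evals \<sigma> g xs y) gs ?ys"
    by (simp add: list_all2_conv_all_nth)
  ultimately show ?case by (blast intro: evals.Comp)
next
  case (PrimRec f g)
  then obtain n zs where xs: "xs = n # zs" by (cases xs) auto
  have "evals \<sigma> (PrimRec f g) (n # zs) y" using PrimRec.prems unfolding xs
  proof (induction n arbitrary: y)
    case 0
    then show ?case by (auto intro: evals.PrimRec_0 PrimRec.IH)
  next
    case (Suc n)
    then obtain r where "stage \<sigma> t (PrimRec f g) (n # zs) = Suc r"
      "stage \<sigma> t g (n # r # zs) = Suc y"
      by (cases "stage \<sigma> t (PrimRec f g) (n # zs)") auto
    with Suc.IH PrimRec.IH(2) show ?case by (blast intro: evals.PrimRec_Suc)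
  qed
  with xs show ?case by simp
next
  case (Mu f)
  define P where "P n \<longleftrightarrow> stage \<sigma> t f (n # xs) = 1 \<and> (\<forall>m<n. 1 < stage \<sigma> t f (m # xs))" for n
  have sum: "(\<Sum>n<t. if P n then Suc n else 0) = Suc y" using Mu.prems by (simp add: P_def)
  then obtain n where n: "n < t" "P n"
    using sum.neutral[of "{..<t}" "\<lambda>n. if P n then Suc n else 0"] by fastforce
  \<comment> \<open>The value 1 at \<open>n\<close> excludes every larger candidate, and a smaller
    one would need value 1 where \<open>n\<close> demands more than 1.\<close>
  have "P m \<longleftrightarrow> m = n" for m
    using n(2) by (cases m n rule: linorder_cases) (auto simp: P_def)
  then have "(\<Sum>n<t. if P n then Suc n else 0) = Suc n" using n(1) by simp
  with sum have "n = y" by simp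
  have "evals \<sigma> f (n # xs) 0" using n(2) by (auto simp: P_def intro: Mu.IH)
  moreover have "\<exists>z>0. evals \<sigma> f (m # xs) z" if "m < n" for m
  proof -
    from n(2) that have "stage \<sigma> t f (m # xs) = Suc (stage \<sigma> t f (m # xs) - 1)"
      "0 < stage \<sigma> t f (m # xs) - 1" by (auto simp: P_def)
    then show ?thesis using Mu.IH by blast
  qed
  ultimately show ?case unfolding \<open>n = y\<close> by (rule evals.Mu)
qed

text \<open>
  Letting the oracle vary with the number of steps covers at once the finiteness of the use and
  the exhaustion of \<open>evals\<close> by \<open>stage\<close>.
\<close>

lemma stage_complete:
  assumes \<tau>: "\<And>x b. \<sigma> x = Some b \<Longrightarrow> \<forall>\<^sub>F t in sequentially. \<tau> t x = Some b"
  shows "evals \<sigma> e xs y \<Longrightarrow> \<forall>\<^sub>F t in sequentially. stage (\<tau> t) t e xs = Suc y"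
proof (induction rule: evals.induct)
  case (Oracle x b)
  from \<tau>[OF Oracle] show ?case by eventually_elim simp
next
  case (Comp xs gs ys f z)
  have "\<forall>\<^sub>F t in sequentially. \<forall>i\<in>{..<length gs}. stage (\<tau> t) t (gs ! i) xs = Suc (ys ! i)"
    using Comp.IH(1) by (auto simp: list_all2_conv_all_nth intro: eventually_ball_finite)
  \<comment> \<open>Finitely many arguments and the outer program have all reached their final
    values from some \<open>t\<close> on.\<close>
  with Comp.IH(2) show ?case
  proof eventually_elim
    case (elim t)
    have "map (\<lambda>g. stage (\<tau> t) t g xs) gs = map Suc ys"
      using elim(2) Comp.IH(1) by (auto simp: list_all2_conv_all_nth intro: nth_equalityI)
    with elim(1) show ?case by (auto simp: Let_def comp_def)
  qed
next
  case (PrimRec_Suc f g n xs y z)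
  from PrimRec_Suc.IH show ?case by eventually_elim simp
next
  case (Mu f n xs)
  have "\<forall>\<^sub>F t in sequentially. 1 < stage (\<tau> t) t f (m # xs)" if "m < n" for m
  proof -
    from Mu.IH(2)[OF that] obtain z where "z > 0"
      "\<forall>\<^sub>F t in sequentially. stage (\<tau> t) t f (m # xs) = Suc z" by blast
    from this(2) show ?thesis by eventually_elim (use \<open>z > 0\<close> in simp)
  qed
  then have "\<forall>\<^sub>F t in sequentially. \<forall>m\<in>{..<n}. 1 < stage (\<tau> t) t f (m # xs)"
    by (intro eventually_ball_finite) auto
  with Mu.IH(1) eventually_gt_at_top[of n] show ?case
  proof eventually_elim
    case (elim t)
    have "stage (\<tau> t) t f (m # xs) = 1 \<and> (\<forall>i<m. 1 < stage (\<tau> t) t f (i # xs)) \<longleftrightarrow> m = n" for m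
    proof (cases m n rule: linorder_cases)
      case greater
      then have "\<not> (\<forall>i<m. 1 < stage (\<tau> t) t f (i # xs))"
        using elim(1) by (metis One_nat_def less_irrefl)
      with greater show ?thesis by auto
    next
      case less
      with elim(3) have "1 < stage (\<tau> t) t f (m # xs)" by blast
      with less show ?thesis by auto
    qed (use elim in auto)
    then show ?case using elim(2) by simp
  qed
qed simp_all

section \<open>Coded finite oracles\<close>

definition list_oracle :: "bool list \<Rightarrow> (nat \<rightharpoonup> bool)" where
  "list_oracle s = (\<lambda>i. if i < length s then Some (s ! i) else None)"

lemma list_oracle_Nil [simp]: "list_oracle [] = Map.empty"
  by (simp add: list_oracle_def)

lemma list_oracle_initial_segment: "list_oracle (A \<restriction> y) = char_oracle A |` {..<y}"
  by (auto simp: list_oracle_def initial_segment_def char_oracle_def restrict_map_def)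

text \<open>\<open>Suc (nat_of_str s)\<close> is the number whose binary expansion is 1 followed by
  \<open>s\<close>, so division by a power of 2 removes trailing symbols.\<close>

lemma Suc_nat_of_str_div: "Suc (nat_of_str (s @ t)) div 2 ^ length t = Suc (nat_of_str s)"
proof (induction t rule: rev_induct)
  case (snoc b t)
  have "Suc (nat_of_str (s @ t @ [b])) div 2 = Suc (nat_of_str (s @ t))"
    using nat_of_str_simps(2)[of "s @ t" b] by simp
  with snoc show ?case by (simp add: div_mult2_eq del: nat_of_str_simps(2))
qed simp

text \<open>Removing everything after position \<open>i\<close> leaves the symbol there as the last
  binary digit.\<close>

lemma odd_Suc_nat_of_str: "i < length s \<Longrightarrow>
    odd (Suc (nat_of_str s) div 2 ^ (length s - Suc i)) \<longleftrightarrow> s ! i"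
proof -
  assume "i < length s"
  then have "Suc (nat_of_str s) div 2 ^ (length s - Suc i) = Suc (nat_of_str (take i s @ [s ! i]))"
    using Suc_nat_of_str_div[of "take (Suc i) s" "drop (Suc i) s"]
    by (simp add: take_Suc_conv_app_nth[symmetric] del: nat_of_str_simps(2))
  then show ?thesis by simp
qed

lemma nat_of_str_bounds: "2 ^ length s \<le> Suc (nat_of_str s) \<and> Suc (nat_of_str s) < 2 ^ Suc (length s)"
  by (induction s rule: rev_induct) auto

lemma length_le_nat_of_str: "length s \<le> nat_of_str s"
  by (induction s rule: rev_induct) auto

lemma length_str_of_nat_le: "length (str_of_nat n) \<le> n"
  using length_le_nat_of_str[of "str_of_nat n"] by simp

lemma less_length_str_of_nat: "j < length (str_of_nat n) \<longleftrightarrow> 2 ^ Suc j \<le> Suc n"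
proof -
  let ?l = "length (str_of_nat n)"
  have b: "2 ^ ?l \<le> Suc n" "Suc n < 2 ^ Suc ?l"
    using nat_of_str_bounds[of "str_of_nat n"] by auto
  show ?thesis
  proof
    assume "j < ?l"
    then have "(2::nat) ^ Suc j \<le> 2 ^ ?l" by (intro power_increasing) auto
    with b(1) show "2 ^ Suc j \<le> Suc n" by simp
  next
    assume "2 ^ Suc j \<le> Suc n"
    with b(2) have "(2::nat) ^ Suc j < 2 ^ Suc ?l" by linarith
    then show "j < ?l" by simp
  qed
qed

lemma computable_length_str_of_nat [comp_intros]:
  assumes "computable k f"
  shows "computable k (\<lambda>xs. length (str_of_nat (f xs)))"
proof -
  \<comment> \<open>A string is no longer than its number, so counting the admissible
    \<open>j < n\<close> gives the full length.\<close>
  have "{..<n} \<inter> {j. j < length (str_of_nat n)} = {..<length (str_of_nat n)}" for n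
    using length_str_of_nat_le[of n] by auto
  then have "length (str_of_nat n) = (\<Sum>j<n. of_bool (2 ^ Suc j \<le> Suc n))" for n
    unfolding less_length_str_of_nat[symmetric] by simp
  moreover have "computable k (\<lambda>xs. \<Sum>j<f xs. of_bool (2 ^ Suc j \<le> Suc (f xs)))"
    by (rule comp_intros assms computable_comp[OF assms])+
  ultimately show ?thesis by simp
qed

lemma decidable_odd [comp_intros]:
  assumes "computable k f"
  shows "decidable k (\<lambda>xs. odd (f xs))"
proof -
  have "odd n \<longleftrightarrow> n - 2 * (n div 2) = 1" for n :: nat
    by presburger
  moreover have "decidable k (\<lambda>xs. f xs - 2 * (f xs div 2) = 1)"
    by (rule comp_intros assms)+
  ultimately show ?thesis by (simp only:)
qed

text \<open>Puts an induction hypothesis of the next lemma into a form that applies to arbitrary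
  computable arguments.\<close>

lemma computable_stage_subst:
  assumes "computable (Suc (Suc m))
      (\<lambda>ys. stage (list_oracle (str_of_nat (hd ys))) (hd (tl ys)) e (tl (tl ys)))"
    and "computable k w" "computable k t" "computable_list k m F"
  shows "computable k (\<lambda>xs. stage (list_oracle (str_of_nat (w xs))) (t xs) e (F xs))"
proof -
  have "computable_list k (Suc (Suc m)) (\<lambda>xs. w xs # t xs # F xs)"
    by (rule comp_intros assms)+
  from computable_comp[OF assms(1) this] show ?thesis by simp
qed

text \<open>The program is fixed while oracle code, step bound and input vary. The arity stays
  arbitrary in the induction because subprograms receive other numbers of arguments; at a wrong
  arity the value is constantly 0.\<close>

lemma computable_stage_aux: "computable (Suc (Suc m))
    (\<lambda>ys. stage (list_oracle (str_of_nat (hd ys))) (hd (tl ys)) e (tl (tl ys)))"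
proof (induction e arbitrary: m)
  case Zero
  show ?case unfolding stage.simps by (rule comp_intros)
next
  case Succ
  show ?case
  proof (cases "m = 1")
    case True
    have "computable (Suc (Suc m)) (\<lambda>ys. Suc (Suc (hd (tl (tl ys)))))"
      unfolding True by (rule comp_intros | simp)+
    then show ?thesis by (rule computable_cong[THEN iffD1, rotated]) (simp add: True)
  next
    case False
    have "computable (Suc (Suc m)) (\<lambda>ys. 0)" by (rule comp_intros)
    then show ?thesis by (rule computable_cong[THEN iffD1, rotated]) (use False in simp)
  qed
next
  case (Proj i)
  show ?case
  proof (cases "i < m")
    case True
    have "computable (Suc (Suc m)) (\<lambda>ys. Suc (ys ! Suc (Suc i)))"
      using True by (auto intro!: comp_intros)
    then show ?thesis
      by (rule computable_cong[THEN iffD1, rotated]) (use True in \<open>simp add: nth_tl\<close>)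
  next
    case False
    have "computable (Suc (Suc m)) (\<lambda>ys. 0)" by (rule comp_intros)
    then show ?thesis by (rule computable_cong[THEN iffD1, rotated]) (use False in simp)
  qed
next
  case Oracle
  show ?case
  proof (cases "m = 1")
    case True
    \<comment> \<open>A query inside the coded string is answered by isolating its bit
      arithmetically; outside it the computation is undefined.\<close>
    have "computable (Suc (Suc (Suc 0))) (\<lambda>ys. if hd (tl (tl ys)) < length (str_of_nat (hd ys))
        then Suc (of_bool (odd (Suc (hd ys) div
          2 ^ (length (str_of_nat (hd ys)) - Suc (hd (tl (tl ys))))))) else 0)"
      by (rule comp_intros)+
    then have "computable (Suc (Suc m)) (\<lambda>ys. if hd (tl (tl ys)) < length (str_of_nat (hd ys))
        then Suc (of_bool (odd (Suc (hd ys) div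
          2 ^ (length (str_of_nat (hd ys)) - Suc (hd (tl (tl ys))))))) else 0)"
      by (simp add: True)
    then show ?thesis
    proof (rule computable_cong[THEN iffD1, rotated], goal_cases)
      case (1 ys)
      then show ?case
        using odd_Suc_nat_of_str[of "hd (tl (tl ys))" "str_of_nat (hd ys)"]
        by (auto simp: True list_oracle_def)
    qed
  next
    case False
    have "computable (Suc (Suc m)) (\<lambda>ys. 0)" by (rule comp_intros)
    then show ?thesis by (rule computable_cong[THEN iffD1, rotated]) (use False in simp)
  qed
next
  case (Comp f gs)
  let ?S = "\<lambda>e xs ys. stage (list_oracle (str_of_nat (hd ys))) (hd (tl ys)) e xs"
  have map: "computable_list (Suc (Suc m)) (length gs)
      (\<lambda>ys. map (\<lambda>g. ?S g (tl (tl ys)) ys - 1) gs)"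
    by (rule computable_list_map) (rule comp_intros Comp.IH(2) | assumption)+
  have dec: "decidable (Suc (Suc m)) (\<lambda>ys. \<exists>g\<in>set gs. ?S g (tl (tl ys)) ys = 0)"
    by (rule decidable_bex_list) (rule comp_intros Comp.IH(2) | assumption)+
  have "computable (Suc (Suc m)) (\<lambda>ys. if \<exists>g\<in>set gs. ?S g (tl (tl ys)) ys = 0 then 0
      else ?S f (map (\<lambda>g. ?S g (tl (tl ys)) ys - 1) gs) ys)"
    by (rule computable_if dec computable_stage_subst[OF Comp.IH(1)] map comp_intros)+
  then show ?case
    by (rule computable_cong[THEN iffD1, rotated]) (auto simp: Let_def comp_def)
next
  case (PrimRec f g)
  show ?case
  proof (cases m)
    case 0
    have "computable (Suc (Suc m)) (\<lambda>ys. 0)" by (rule comp_intros)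
    then show ?thesis
      by (rule computable_cong[THEN iffD1, rotated]) (auto simp: 0 length_Suc_conv)
  next
    case (Suc m')
    let ?S = "\<lambda>e xs ys. stage (list_oracle (str_of_nat (hd ys))) (hd (tl ys)) e xs"
    have "computable (Suc (Suc (Suc m'))) (\<lambda>ys. rec_nat (?S f (tl (tl (tl ys))) ys)
        (\<lambda>i r. if r = 0 then 0 else ?S g (i # (r - 1) # tl (tl (tl ys))) ys) (hd (tl (tl ys))))"
      by (rule computable_rec[where a = "\<lambda>ys. ?S f (tl (tl (tl ys))) ys"
            and h = "\<lambda>i r ys. if r = 0 then 0 else ?S g (i # (r - 1) # tl (tl (tl ys))) ys"])
        (rule comp_intros computable_stage_subst[OF PrimRec.IH(1)]
            computable_stage_subst[OF PrimRec.IH(2)] | simp)+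
    then have "computable (Suc (Suc m)) (\<lambda>ys. rec_nat (?S f (tl (tl (tl ys))) ys)
        (\<lambda>i r. if r = 0 then 0 else ?S g (i # (r - 1) # tl (tl (tl ys))) ys) (hd (tl (tl ys))))"
      by (simp add: Suc)
    then show ?thesis
      by (rule computable_cong[THEN iffD1, rotated]) (auto simp: Suc length_Suc_conv cong: if_cong)
  qed
next
  case (Mu f)
  show ?case unfolding stage.simps
    by (rule comp_intros computable_stage_subst[OF Mu.IH])+
qed

lemmas computable_stage [comp_intros] = computable_stage_subst[OF computable_stage_aux]

lemma str_of_nat_0 [simp]: "str_of_nat 0 = []"
  using nat_of_str_inverse[of "[]"] by simp

lemma computable_stage_empty [comp_intros]:
  assumes "computable k t" "computable_list k m F"
  shows "computable k (\<lambda>xs. stage Map.empty (t xs) e (F xs))"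
  using computable_stage[OF computable_const[of k 0] assms, of e] by simp

lemma evals_iff_stage: "evals \<sigma> e xs y \<longleftrightarrow> (\<exists>t. stage \<sigma> t e xs = Suc y)"
proof
  assume "evals \<sigma> e xs y"
  then have "\<forall>\<^sub>F t in sequentially. stage \<sigma> t e xs = Suc y"
    using stage_complete[of \<sigma> "\<lambda>t. \<sigma>"] by simp
  then show "\<exists>t. stage \<sigma> t e xs = Suc y"
    by (auto simp: eventually_sequentially)
qed (auto intro: stage_sound)

lemma evals_ex_iff_stage: "(\<exists>y. evals \<sigma> e xs y) \<longleftrightarrow> (\<exists>t. 0 < stage \<sigma> t e xs)"
  unfolding evals_iff_stage by (metis Suc_pred zero_less_Suc)

text \<open>Searching for a step bound at which \<open>stage\<close> is nonzero replaces a finite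
  oracle by its code as an ordinary argument; subtracting 1 undoes the shift in the output.\<close>

lemma oracle_as_argument:
  obtains d where "\<And>z w y. evals (list_oracle (str_of_nat w)) e [z] y
    \<Longrightarrow> evals Map.empty d [z, w] y"
proof -
  let ?S = "\<lambda>t xs. stage (list_oracle (str_of_nat (hd (tl xs)))) t e [hd xs]"
  obtain d where d: "\<And>xs y. length xs = Suc (Suc 0) \<Longrightarrow> evals Map.empty d xs y \<longleftrightarrow>
      (\<exists>t. 0 < ?S t xs) \<and> y = ?S (LEAST t. 0 < ?S t xs) xs - 1"
    by (rule computable_search[of "Suc (Suc 0)" "\<lambda>t xs. 0 < ?S t xs" "\<lambda>t xs. ?S t xs - 1"])
      ((rule comp_intros)+, blast)
  show thesis
  proof (rule that)
    fix z w y
    assume y: "evals (list_oracle (str_of_nat w)) e [z] y"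
    then have ex: "\<exists>t. 0 < ?S t [z, w]"
      using evals_ex_iff_stage[of "list_oracle (str_of_nat w)" e "[z]"] by auto
    define t where "t = (LEAST t. 0 < ?S t [z, w])"
    have "0 < ?S t [z, w]" unfolding t_def using ex by (rule LeastI_ex)
    then have "evals (list_oracle (str_of_nat w)) e [z] (?S t [z, w] - 1)"
      by (intro stage_sound) simp
    with y have "y = ?S t [z, w] - 1" by (rule evals_deterministic)
    with ex d[of "[z, w]"] show "evals Map.empty d [z, w] y"
      unfolding t_def by simp
  qed
qed

section \<open>The pairing function\<close>

lemma computable_prod_encode [comp_intros]:
  assumes "computable k f" "computable k g"
  shows "computable k (\<lambda>xs. prod_encode (f xs, g xs))"
  unfolding prod_encode_def triangle_def prod.case by (rule comp_intros assms)+

text \<open>Both components of a pair are bounded by its code, so the double sum selects exactly the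
  decoded pair.\<close>

lemma sum_prod_decode:
  "(\<Sum>a<Suc n. \<Sum>b<Suc n. if prod_encode (a, b) = n then F a b else 0) =
    F (fst (prod_decode n)) (snd (prod_decode n))" for F :: "nat \<Rightarrow> nat \<Rightarrow> nat"
proof -
  obtain a b where ab: "prod_decode n = (a, b)" by fastforce
  then have n: "n = prod_encode (a, b)" by (metis prod_decode_inverse)
  then have le: "a < Suc n" "b < Suc n"
    by (simp_all add: less_Suc_eq_le le_prod_encode_1 le_prod_encode_2)
  have "(\<Sum>a'<Suc n. \<Sum>b'<Suc n. if prod_encode (a', b') = n then F a' b' else 0) =
      (\<Sum>a'<Suc n. if a' = a then \<Sum>b'<Suc n. if b' = b then F a' b' else 0 else 0)"
    by (intro sum.cong refl) (auto simp: n prod_encode_eq intro!: sum.cong sum.neutral)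
  also have "\<dots> = F a b" using le by (simp del: sum.lessThan_Suc)
  finally show ?thesis by (simp add: ab)
qed

lemma computable_prod_decode [comp_intros]:
  assumes "computable k f"
  shows "computable k (\<lambda>xs. fst (prod_decode (f xs)))"
    and "computable k (\<lambda>xs. snd (prod_decode (f xs)))"
proof -
  have "computable k (\<lambda>xs. \<Sum>a<Suc (f xs). \<Sum>b<Suc (f xs).
      if prod_encode (a, b) = f xs then a else 0)"
    by (rule comp_intros assms computable_comp[OF assms])+
  then show "computable k (\<lambda>xs. fst (prod_decode (f xs)))"
    unfolding sum_prod_decode .
  have "computable k (\<lambda>xs. \<Sum>a<Suc (f xs). \<Sum>b<Suc (f xs).
      if prod_encode (a, b) = f xs then b else 0)"
    by (rule comp_intros assms computable_comp[OF assms])+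
  then show "computable k (\<lambda>xs. snd (prod_decode (f xs)))"
    unfolding sum_prod_decode .
qed

section \<open>Reducibilities\<close>

lemma initial_segment_Suc: "A \<restriction> Suc n = A \<restriction> n @ [n \<in> A]"
  by (simp add: initial_segment_def)

lemma length_initial_segment [simp]: "length (A \<restriction> n) = n"
  by (simp add: initial_segment_def)

text \<open>Weak Koenig's lemma. A string with extensions in \<open>T\<close> of every length has a
  one-symbol extension with the same property; otherwise both branches would die out at finite
  lengths.\<close>

lemma infinite_binary_tree_path:
  assumes prefix: "\<And>s t. T (s @ t) \<Longrightarrow> T s"
    and inf: "\<And>n. \<exists>s. length s = n \<and> T s"
  shows "\<exists>X. \<forall>n. T (X \<restriction> n)"
proof -
  define E where "E s \<longleftrightarrow> (\<forall>n. \<exists>t. length t = n \<and> T (s @ t))" for s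
  have step: "\<exists>b. E (s @ [b])" if "E s" for s
  proof (rule ccontr)
    assume "\<not> (\<exists>b. E (s @ [b]))"
    then obtain l where l: "\<And>b t. length t = l b \<Longrightarrow> \<not> T (s @ b # t)"
      unfolding E_def by simp metis
    obtain t where t: "length t = Suc (max (l True) (l False))" "T (s @ t)"
      using \<open>E s\<close> unfolding E_def by blast
    then obtain b t' where bt: "t = b # t'" by (cases t) auto
    have "T ((s @ b # take (l b) t') @ drop (l b) t')" using t(2) by (simp add: bt)
    then have "T (s @ b # take (l b) t')" by (rule prefix)
    moreover have "length (take (l b) t') = l b" using t(1) by (cases b) (auto simp: bt)
    ultimately show False using l by blast
  qed
  define S where "S = rec_nat [] (\<lambda>_ s. s @ [SOME b. E (s @ [b])])"
  have S: "E (S n)" for n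
  proof (induction n)
    case 0
    show ?case using inf by (simp add: S_def E_def)
  next
    case (Suc n)
    then show ?case using someI_ex[OF step] by (simp add: S_def)
  qed
  define X where "X = {n. SOME b. E (S n @ [b])}"
  have "X \<restriction> n = S n" for n
    by (induction n) (simp_all add: initial_segment_Suc X_def S_def, simp add: initial_segment_def)
  moreover have "T (S n)" for n
    using S[of n] prefix unfolding E_def by blast
  ultimately show ?thesis by metis
qed

lemma char_oracle_restrict_le: "m \<le> n \<Longrightarrow> char_oracle A |` {..<m} \<subseteq>\<^sub>m char_oracle A |` {..<n}"
  by (auto simp: map_le_def restrict_map_def)

lemma char_oracle_restrict_le_full: "char_oracle A |` S \<subseteq>\<^sub>m char_oracle A"
  by (auto simp: map_le_def restrict_map_def)

lemma list_oracle_append_le: "list_oracle s \<subseteq>\<^sub>m list_oracle (s @ t)"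
  by (auto simp: map_le_def list_oracle_def nth_append split: if_splits)

lemma evals_char_oracle: "evals (char_oracle X) Oracle [n] (of_bool (n \<in> X))"
  by (rule evals.Oracle) (simp add: char_oracle_def)

lemma evals_oracle_free: "evals Map.empty e xs y \<Longrightarrow> evals \<sigma> e xs y"
  by (erule evals_mono) simp

text \<open>Compactness of Cantor space bounds the number of oracle bits used by a total functional.\<close>

lemma uniform_use:
  assumes "\<And>X. \<exists>y. evals (char_oracle X) e xs y"
  obtains m where "\<And>s. length s = m \<Longrightarrow> \<exists>y. evals (list_oracle s) e xs y"
proof (rule ccontr)
  assume "\<not> thesis"
  \<comment> \<open>The strings on which the computation diverges form a tree, since a shorter
    oracle answers fewer queries. It has elements of every length, hence a path.\<close>
  then have "\<exists>s. length s = m \<and> \<not> (\<exists>y. evals (list_oracle s) e xs y)" for m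
    using that by blast
  moreover have "\<not> (\<exists>y. evals (list_oracle s) e xs y)"
    if "\<not> (\<exists>y. evals (list_oracle (s @ t)) e xs y)" for s t
    using that evals_mono[OF _ list_oracle_append_le] by blast
  ultimately obtain X where X: "\<And>n. \<not> (\<exists>y. evals (list_oracle (X \<restriction> n)) e xs y)"
    using infinite_binary_tree_path[of "\<lambda>s. \<not> (\<exists>y. evals (list_oracle s) e xs y)"] by blast
  obtain y where y: "evals (char_oracle X) e xs y" using assms by blast
  have "\<forall>\<^sub>F t in sequentially. (char_oracle X |` {..<t}) x = Some b"
    if "char_oracle X x = Some b" for x b
    using eventually_gt_at_top[of x] by eventually_elim (use that in simp)
  then have "\<forall>\<^sub>F t in sequentially. stage (char_oracle X |` {..<t}) t e xs = Suc y"
    by (rule stage_complete) (use y in auto)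
  \<comment> \<open>At step \<open>t\<close> the oracle is \<open>X\<close> cut off at
    \<open>t\<close>, so one \<open>t\<close> bounds the running time and the queries
    together.\<close>
  then obtain t where "stage (char_oracle X |` {..<t}) t e xs = Suc y"
    by (auto simp: eventually_sequentially)
  then have "evals (list_oracle (X \<restriction> t)) e xs y"
    unfolding list_oracle_initial_segment by (rule stage_sound)
  with X show False by blast
qed

text \<open>Compactness makes a search for a recursive use bound terminate: wait until all strings
  of some length are seen to give halting computations.\<close>

lemma tt_imp_wtt:
  assumes "f \<le>tt A"
  shows "f \<le>wtt A"
proof -
  obtain e where total: "\<And>X x. \<exists>y. evals (char_oracle X) e [x] y"
    and f: "\<And>x. evals (char_oracle A) e [x] (f x)"
    using assms unfolding tt_reducible_def by blast
  \<comment> \<open>A single number bounds both the length \<open>m\<close> and the number of steps.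
    All strings of length \<open>m\<close> have codes below \<open>2 ^ Suc m\<close>.\<close>
  define P where "P t x \<longleftrightarrow> (\<exists>m<Suc t. \<forall>w<2 ^ Suc m. \<not> length (str_of_nat w) = m \<or>
      0 < stage (list_oracle (str_of_nat w)) t e [x])" for t x
  have ex: "\<exists>t. P t x" for x
  proof -
    obtain m where m: "\<And>s. length s = m \<Longrightarrow> \<exists>y. evals (list_oracle s) e [x] y"
      using uniform_use[OF total] by blast
    have "\<forall>\<^sub>F t in sequentially. 0 < stage (list_oracle s) t e [x]" if s: "length s = m" for s
    proof -
      obtain y where "evals (list_oracle s) e [x] y" using m[OF s] by blast
      then have "\<forall>\<^sub>F t in sequentially. stage (list_oracle s) t e [x] = Suc y"
        using stage_complete[of "list_oracle s" "\<lambda>t. list_oracle s"] by simp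
      then show ?thesis by eventually_elim simp
    qed
    moreover have "finite {s :: bool list. length s = m}"
      using finite_lists_length_eq[of "UNIV :: bool set" m] by simp
    ultimately have "\<forall>\<^sub>F t in sequentially. \<forall>s\<in>{s. length s = m}. 0 < stage (list_oracle s) t e [x]"
      by (intro eventually_ball_finite) auto
    with eventually_ge_at_top[of m]
    have "\<forall>\<^sub>F t in sequentially. P t x"
      by eventually_elim (auto simp: P_def less_Suc_eq_le)
    then show ?thesis by (auto simp: eventually_sequentially)
  qed
  define u where "u x = (LEAST t. P t x)" for x
  have "recursive u"
    unfolding recursive_iff_computable u_def
  proof (rule computable_Least)
    show "decidable (Suc (Suc 0)) (\<lambda>ys. P (hd ys) (hd (tl ys)))"
      unfolding P_def by (rule comp_intros)+
  qed (use ex in blast)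
  moreover have "evals (char_oracle A |` {..<u x}) e [x] (f x)" for x
  proof -
    have "P (u x) x" unfolding u_def using ex by (rule LeastI_ex)
    then obtain m where m: "m \<le> u x"
      "\<And>w. w < 2 ^ Suc m \<Longrightarrow> length (str_of_nat w) = m \<Longrightarrow>
        0 < stage (list_oracle (str_of_nat w)) (u x) e [x]"
      unfolding P_def less_Suc_eq_le by blast
    have "nat_of_str (A \<restriction> m) < 2 ^ Suc m"
      using nat_of_str_bounds[of "A \<restriction> m"] by simp
    from m(2)[OF this] have "0 < stage (char_oracle A |` {..<m}) (u x) e [x]"
      by (simp add: list_oracle_initial_segment)
    then obtain y where "evals (char_oracle A |` {..<m}) e [x] y"
      using evals_ex_iff_stage by blast
    \<comment> \<open>The search parameter is at least \<open>m\<close>, so it is itself a valid use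
      bound.\<close>
    then have y: "evals (char_oracle A |` {..<u x}) e [x] y"
      using evals_mono char_oracle_restrict_le[OF m(1)] by blast
    then have "evals (char_oracle A) e [x] y"
      using evals_mono char_oracle_restrict_le_full by blast
    with f have "y = f x" by (blast intro: evals_deterministic)
    with y show ?thesis by simp
  qed
  ultimately show ?thesis unfolding wtt_reducible_def by blast
qed

section \<open>Reparametrisation by recursive functions\<close>

lemma evals_Comp1: "evals \<sigma> g xs y \<Longrightarrow> evals \<sigma> f [y] z \<Longrightarrow> evals \<sigma> (Comp f [g]) xs z"
  by (rule evals.Comp[of _ _ _ "[y]"]) auto

lemma evals_Comp2: "evals \<sigma> g xs y \<Longrightarrow> evals \<sigma> h xs y' \<Longrightarrow> evals \<sigma> f [y, y'] z
    \<Longrightarrow> evals \<sigma> (Comp f [g, h]) xs z"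
  by (rule evals.Comp[of _ _ _ "[y, y']"]) auto

lemma evals_Proj: "i < length xs \<Longrightarrow> xs ! i = y \<Longrightarrow> evals \<sigma> (Proj i) xs y"
  using evals.Proj by blast

lemma tt_recursive_comp:
  assumes "f \<le>tt A" "recursive r"
  shows "(\<lambda>x. f (r x)) \<le>tt A"
proof -
  obtain e where e: "\<And>X x. \<exists>y. evals (char_oracle X) e [x] y"
    "\<And>x. evals (char_oracle A) e [x] (f x)"
    using assms(1) unfolding tt_reducible_def by blast
  obtain d where d: "\<And>\<sigma> x. evals \<sigma> d [x] (r x)"
    using assms(2) unfolding recursive_iff by (blast intro: evals_oracle_free)
  from e d show ?thesis
    unfolding tt_reducible_def by (intro exI[of _ "Comp e [d]"]) (blast intro: evals_Comp1)
qed

lemma wtt_recursive_comp: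
  assumes "f \<le>wtt A" "recursive r"
  shows "(\<lambda>x. f (r x)) \<le>wtt A"
proof -
  obtain e u where u: "recursive u"
    and e: "\<And>x. evals (char_oracle A |` {..<u x}) e [x] (f x)"
    using assms(1) unfolding wtt_reducible_def by blast
  obtain d where d: "\<And>\<sigma> x. evals \<sigma> d [x] (r x)"
    using assms(2) unfolding recursive_iff by (blast intro: evals_oracle_free)
  have "recursive (\<lambda>x. u (r x))"
    unfolding recursive_iff_computable
    by (rule computable_recursive[OF u] computable_recursive[OF assms(2)] comp_intros)+
  with e d show ?thesis
    unfolding wtt_reducible_def
    by (intro exI[of _ "Comp e [d]"] exI[of _ "\<lambda>x. u (r x)"]) (blast intro: evals_Comp1)
qed

section \<open>Kolmogorov complexity of computed values\<close>

text \<open>Reading the outputs of \<open>V\<close> as strings gives a machine, to which optimality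
  of \<open>U\<close> applies.\<close>

lemma complexity_le_length:
  assumes "universal_machine U" "str_partial_recursive V"
  obtains c where "\<And>p v. V p = Some v \<Longrightarrow> plain_complexity U (str_of_nat v) \<le> length p + c"
proof -
  have "machine (\<lambda>p. map_option str_of_nat (V p))"
    using assms(2) by (simp add: machine_def option.map_comp comp_def option.map_ident)
  then obtain c where c: "\<And>p x. map_option str_of_nat (V p) = Some x \<Longrightarrow>
      \<exists>q. U q = Some x \<and> length q \<le> length p + c"
    using assms(1) unfolding universal_machine_def by blast
  have "plain_complexity U (str_of_nat v) \<le> length p + c" if "V p = Some v" for p v
  proof -
    from c[of p "str_of_nat v"] that obtain q where
      "U q = Some (str_of_nat v)" "length q \<le> length p + c" by auto
    then show ?thesis
      unfolding plain_complexity_def by (blast intro: Least_le order_trans)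
  qed
  with that show thesis by blast
qed

text \<open>The string numbered \<open>n\<close> serves as program; its length is at most
  \<open>n\<close>.\<close>

lemma complexity_le_input:
  assumes "universal_machine U" "partial_recursive \<theta>"
  obtains c where "\<And>n v. \<theta> n = Some v \<Longrightarrow> plain_complexity U (str_of_nat v) \<le> n + c"
proof -
  have "str_partial_recursive (\<lambda>p. \<theta> (nat_of_str p))"
    using assms(2) by (simp add: str_partial_recursive_def)
  then obtain c where c: "\<And>p v. \<theta> (nat_of_str p) = Some v \<Longrightarrow>
      plain_complexity U (str_of_nat v) \<le> length p + c"
    using complexity_le_length[OF assms(1)] by blast
  have "plain_complexity U (str_of_nat v) \<le> n + c" if "\<theta> n = Some v" for n v
    using c[of "str_of_nat n" v] length_str_of_nat_le[of n] that by simp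
  with that show thesis by blast
qed

section \<open>Enumeration, s-m-n and the diagonal function\<close>

lemma acceptable_numbering_program:
  assumes "acceptable_numbering \<phi>"
  obtains e where "\<And>x y z. \<phi> x y = Some z \<longleftrightarrow> evals Map.empty e [x, y] z"
  using assms unfolding acceptable_numbering_def partial_recursive2_def by blast

lemma acceptable_numbering_smn:
  assumes "acceptable_numbering \<phi>"
  obtains s where "recursive s" "\<And>x y z. \<phi> (s x) y = Some z \<longleftrightarrow> evals Map.empty e [x, y] z"
proof -
  define \<psi> where "\<psi> x y = (if \<exists>z. evals Map.empty e [x, y] z
      then Some (THE z. evals Map.empty e [x, y] z) else None)" for x y
  have \<psi>: "\<psi> x y = Some z \<longleftrightarrow> evals Map.empty e [x, y] z" for x y z
    unfolding \<psi>_def by (auto intro: theI evals_deterministic the_equality)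
  then have "partial_recursive2 \<psi>" unfolding partial_recursive2_def by blast
  then obtain s where "recursive s" "\<And>x. \<phi> (s x) = \<psi> x"
    using assms unfolding acceptable_numbering_def by blast
  with that[of s] \<psi> show thesis by simp
qed

lemma partial_recursive_diagonal:
  assumes "acceptable_numbering \<phi>"
  shows "partial_recursive (\<lambda>x. \<phi> x x)"
proof -
  obtain e where e: "\<And>x y z. \<phi> x y = Some z \<longleftrightarrow> evals Map.empty e [x, y] z"
    using acceptable_numbering_program[OF assms] by blast
  have "evals Map.empty e [x, x] z \<longleftrightarrow> evals Map.empty (Comp e [Proj 0, Proj 0]) [x] z" for x z
  proof
    assume "evals Map.empty (Comp e [Proj 0, Proj 0]) [x] z"
    then show "evals Map.empty e [x, x] z"
      by cases (auto simp: list_all2_Cons1 elim!: evals.cases[of _ "Proj 0"])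
  qed (auto intro!: evals_Comp2 evals_Proj)
  with e show ?thesis unfolding partial_recursive_def by blast
qed

section \<open>The implications between the conditions\<close>

text \<open>The length of the initial segment is computed without the oracle, so reading that many
  bits halts for every oracle and the reduction is truth-table.\<close>

lemma complex_set_imp_incompressible:
  assumes "complex_set U A"
  obtains f where "f \<le>tt A" "\<And>n. n \<le> plain_complexity U (str_of_nat (f n))"
proof -
  obtain g where g: "recursive g" "\<And>k. \<exists>y. k \<le> g y" "\<And>y. g y \<le> plain_complexity U (A \<restriction> y)"
    using assms unfolding complex_set_def by blast
  define l where "l n = (LEAST y. n \<le> g y)" for n
  have l: "n \<le> g (l n)" for n unfolding l_def using g(2) by (rule LeastI_ex)
  have "recursive l"
    unfolding recursive_iff_computable l_def
    by (rule computable_Least, (rule computable_recursive[OF g(1)] comp_intros)+) (rule g(2))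
  then obtain d where d: "\<And>\<sigma> n. evals \<sigma> d [n] (l n)"
    unfolding recursive_iff by (blast intro: evals_oracle_free)
  have "computable (Suc (Suc 0)) (\<lambda>xs. Suc (2 * hd xs + hd (tl xs)))"
    by (rule comp_intros)+
  then obtain a where "\<And>xs. length xs = Suc (Suc 0) \<Longrightarrow>
      evals Map.empty a xs (Suc (2 * hd xs + hd (tl xs)))"
    unfolding computable_def by blast
  from this[of "[x, y]" for x y] have a: "evals \<sigma> a [x, y] (Suc (2 * x + y))" for \<sigma> x y
    by (simp add: evals_oracle_free)
  \<comment> \<open>Appending a bit \<open>b\<close> turns a code \<open>c\<close> into
    \<open>2 * c + 1 + b\<close>; \<open>Proj 1\<close> is the code so far and \<open>Proj 0\<close>
    the next position to query.\<close>
  define p where "p = PrimRec Zero (Comp a [Proj 1, Comp Oracle [Proj 0]])"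
  have p: "evals (char_oracle X) p [n] (nat_of_str (X \<restriction> n))" for X n
  proof (induction n)
    case 0
    show ?case unfolding p_def by (auto simp: initial_segment_def intro!: evals.PrimRec_0 evals.Zero)
  next
    case (Suc n)
    have "evals (char_oracle X) (Comp a [Proj 1, Comp Oracle [Proj 0]])
        [n, nat_of_str (X \<restriction> n)] (Suc (2 * nat_of_str (X \<restriction> n) + of_bool (n \<in> X)))"
      by (rule evals_Comp2[OF _ evals_Comp1[OF _ evals_char_oracle] a]) (auto intro!: evals_Proj)
    then show ?case
      using Suc unfolding p_def
      by (auto simp: initial_segment_Suc intro!: evals.PrimRec_Suc split: if_splits)
  qed
  show thesis
  proof (rule that)
    show "(\<lambda>n. nat_of_str (A \<restriction> l n)) \<le>tt A"
      unfolding tt_reducible_def using d p by (intro exI[of _ "Comp p [d]"]) (blast intro: evals_Comp1)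
    show "n \<le> plain_complexity U (str_of_nat (nat_of_str (A \<restriction> l n)))" for n
      using l[of n] g(3)[of "l n"] by simp
  qed
qed

text \<open>For \<open>y \<le> x\<close> the value of \<phi> at \<open>y, y\<close> has complexity
  at most \<open>x + c\<close>, below that of \<open>f (Suc (x + c))\<close>.\<close>

lemma incompressible_imp_SDNR:
  assumes "acceptable_numbering \<phi>" "universal_machine U"
    and f: "\<And>n. n \<le> plain_complexity U (str_of_nat (f n))"
  obtains r where "recursive r" "SDNR \<phi> (\<lambda>x. f (r x))"
proof -
  obtain c where c: "\<And>n v. \<phi> n n = Some v \<Longrightarrow> plain_complexity U (str_of_nat v) \<le> n + c"
    using complexity_le_input[OF assms(2) partial_recursive_diagonal[OF assms(1)]] by blast
  show thesis
  proof (rule that)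
    show "recursive (\<lambda>x. Suc (x + c))"
      unfolding recursive_iff_computable by (rule comp_intros)+
    have "\<phi> y y \<noteq> Some (f (Suc (x + c)))" if "y \<le> x" for x y
      using c[of y "f (Suc (x + c))"] f[of "Suc (x + c)"] that by auto
    then show "SDNR \<phi> (\<lambda>x. f (Suc (x + c)))" by (simp add: SDNR_def)
  qed
qed

lemma SDNR_imp_DNR: "SDNR \<phi> f \<Longrightarrow> DNR \<phi> f"
  by (simp add: SDNR_def DNR_def)

text \<open>Outputs of programs shorter than \<open>n\<close> have complexity below
  \<open>n + c\<close>; doubling the argument absorbs the constant once
  \<open>n > c\<close>.\<close>

lemma incompressible_avoids_short_programs:
  assumes "universal_machine U" "str_partial_recursive V"
    and f: "\<And>n. n \<le> plain_complexity U (str_of_nat (f n))"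
  shows "\<forall>\<^sub>\<infinity>n. f (2 * n) \<notin> {v. \<exists>p. length p < n \<and> V p = Some v}"
proof -
  obtain c where c: "\<And>p v. V p = Some v \<Longrightarrow> plain_complexity U (str_of_nat v) \<le> length p + c"
    using complexity_le_length[OF assms(1,2)] by blast
  have "f (2 * n) \<notin> {v. \<exists>p. length p < n \<and> V p = Some v}" if "c < n" for n
    using c[of _ "f (2 * n)"] f[of "2 * n"] that by fastforce
  then show ?thesis unfolding MOST_nat by blast
qed

text \<open>Let \<open>V\<close> compute the diagonal. The argument \<open>Suc (x + N)\<close>
  exceeds both the finitely many exceptions and the length of the string numbered
  \<open>x\<close>.\<close>

lemma avoids_short_programs_imp_DNR:
  assumes "acceptable_numbering \<phi>"
    and f: "\<And>V. str_partial_recursive V \<Longrightarrow>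
      \<forall>\<^sub>\<infinity>n. f n \<notin> {v. \<exists>p. length p < n \<and> V p = Some v}"
  obtains r where "recursive r" "DNR \<phi> (\<lambda>x. f (r x))"
proof -
  have "str_partial_recursive (\<lambda>p. \<phi> (nat_of_str p) (nat_of_str p))"
    using partial_recursive_diagonal[OF assms(1)] by (simp add: str_partial_recursive_def)
  from f[OF this] obtain N where N: "\<And>n p. N < n \<Longrightarrow> length p < n \<Longrightarrow>
      \<phi> (nat_of_str p) (nat_of_str p) \<noteq> Some (f n)"
    unfolding MOST_nat by blast
  show thesis
  proof (rule that)
    show "recursive (\<lambda>x. Suc (x + N))"
      unfolding recursive_iff_computable by (rule comp_intros)+
    have "\<phi> x x \<noteq> Some (f (Suc (x + N)))" for x
      using N[of "Suc (x + N)" "str_of_nat x"] length_str_of_nat_le[of x] by simp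
    then show "DNR \<phi> (\<lambda>x. f (Suc (x + N)))" by (simp add: DNR_def)
  qed
qed

text \<open>Each diagonal value is put into sets of size at most one at infinitely many positions,
  so a position beyond the exceptions can be chosen for every \<open>x\<close>.\<close>

lemma avoids_small_sets_imp_DNR:
  assumes "acceptable_numbering \<phi>"
    and f: "\<And>h. recursive h \<Longrightarrow> (\<And>n. finite (W \<phi> (h n)) \<and> card (W \<phi> (h n)) < 2) \<Longrightarrow>
      \<forall>\<^sub>\<infinity>n. f n \<notin> W \<phi> (h n)"
  obtains r where "recursive r" "DNR \<phi> (\<lambda>x. f (r x))"
proof -
  obtain e where e: "\<And>x y z. \<phi> x y = Some z \<longleftrightarrow> evals Map.empty e [x, y] z"
    using acceptable_numbering_program[OF assms(1)] by blast
  let ?l = "\<lambda>n. fst (prod_decode n)"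
  \<comment> \<open>Only the domain matters: \<open>d\<close> halts on \<open>z\<close> exactly when
    the diagonal value is \<open>z\<close>, and its output 0 is arbitrary.\<close>
  obtain d where d: "\<And>xs y. length xs = Suc (Suc 0) \<Longrightarrow> evals Map.empty d xs y \<longleftrightarrow>
      (\<exists>t. stage Map.empty t e [?l (hd xs), ?l (hd xs)] = Suc (hd (tl xs))) \<and> y = 0"
    by (rule computable_search[of "Suc (Suc 0)"
          "\<lambda>t xs. stage Map.empty t e [?l (hd xs), ?l (hd xs)] = Suc (hd (tl xs))" "\<lambda>t xs. 0"])
      ((rule comp_intros)+, blast)
  obtain h where h: "recursive h" "\<And>x y z. \<phi> (h x) y = Some z \<longleftrightarrow> evals Map.empty d [x, y] z"
    using acceptable_numbering_smn[OF assms(1)] by blast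
  have W: "W \<phi> (h n) = {z. \<phi> (?l n) (?l n) = Some z}" for n
    unfolding W_def dom_def e evals_iff_stage by (auto simp: h(2) d)
  have "finite (W \<phi> (h n)) \<and> card (W \<phi> (h n)) < 2" for n
    unfolding W by (cases "\<phi> (?l n) (?l n)") auto
  from f[OF h(1) this] obtain N where N: "\<And>n. N < n \<Longrightarrow> \<phi> (?l n) (?l n) \<noteq> Some (f n)"
    unfolding MOST_nat W by blast
  show thesis
  proof (rule that)
    \<comment> \<open>The second component forces the code above \<open>N\<close> and leaves the
      decoded first component equal to \<open>x\<close>.\<close>
    show "recursive (\<lambda>x. prod_encode (x, Suc N))"
      unfolding recursive_iff_computable by (rule comp_intros)+
    have "\<phi> x x \<noteq> Some (f (prod_encode (x, Suc N)))" for x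
      using N[of "prod_encode (x, Suc N)"] le_prod_encode_2[of "Suc N" x] by simp
    then show "DNR \<phi> (\<lambda>x. f (prod_encode (x, Suc N)))" by (simp add: DNR_def)
  qed
qed

text \<open>
  In an enumeration of \<open>W \<phi> (h n)\<close>, a pair \<open>(z, t)\<close> with \<open>t\<close> the first number of steps at which
  \<open>\<phi> (h n) z\<close> is seen to halt counts as one step, so that no element is enumerated twice;
  \<open>\<theta>\<close> maps \<open>(n, i)\<close> to the \<open>i\<close>-th element.
\<close>

lemma enumerate_W:
  assumes "acceptable_numbering \<phi>" "recursive h"
  obtains \<theta> where "partial_recursive \<theta>"
    "\<And>n z. finite (W \<phi> (h n)) \<Longrightarrow> z \<in> W \<phi> (h n) \<Longrightarrow>
      \<exists>i<card (W \<phi> (h n)). \<theta> (prod_encode (n, i)) = Some z"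
proof -
  obtain e where e: "\<And>x y z. \<phi> x y = Some z \<longleftrightarrow> evals Map.empty e [x, y] z"
    using acceptable_numbering_program[OF assms(1)] by blast
  let ?S = "\<lambda>n z t. stage Map.empty t e [h n, z]"
  let ?l = "\<lambda>n. fst (prod_decode n)"
  let ?r = "\<lambda>n. snd (prod_decode n)"
  define H where "H n s \<longleftrightarrow> 0 < ?S n (?l s) (?r s) \<and> (\<forall>t<?r s. ?S n (?l s) t = 0)" for n s
  have W: "z \<in> W \<phi> (h n) \<longleftrightarrow> (\<exists>s. H n s \<and> ?l s = z)" for n z
  proof -
    have "z \<in> W \<phi> (h n) \<longleftrightarrow> (\<exists>y. evals Map.empty e [h n, z] y)"
      by (auto simp: W_def dom_def e[symmetric])
    also have "\<dots> \<longleftrightarrow> (\<exists>t. 0 < ?S n z t)"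
      by (rule evals_ex_iff_stage)
    also have "\<dots> \<longleftrightarrow> (\<exists>t. 0 < ?S n z t \<and> (\<forall>t'<t. ?S n z t' = 0))"
      using exists_least_iff[of "\<lambda>t. 0 < ?S n z t"] unfolding not_gr_zero .
    also have "\<dots> \<longleftrightarrow> (\<exists>s. H n s \<and> ?l s = z)"
    proof
      assume "\<exists>t. 0 < ?S n z t \<and> (\<forall>t'<t. ?S n z t' = 0)"
      then obtain t where "0 < ?S n z t \<and> (\<forall>t'<t. ?S n z t' = 0)" ..
      then have "H n (prod_encode (z, t)) \<and> ?l (prod_encode (z, t)) = z"
        by (simp add: H_def)
      then show "\<exists>s. H n s \<and> ?l s = z" ..
    qed (auto simp: H_def)
    finally show ?thesis .
  qed
  \<comment> \<open>The first halting time is determined by the element, so an element has only one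
    code.\<close>
  have inj: "inj_on ?l {s. H n s}" for n
  proof (rule inj_onI)
    fix s s' assume *: "s \<in> {s. H n s}" "s' \<in> {s. H n s}" "?l s = ?l s'"
    then have "?r s = ?r s'"
      by (cases "?r s" "?r s'" rule: linorder_cases) (auto simp: H_def)
    with *(3) show "s = s'" by (metis prod_decode_inverse prod_eqI)
  qed
  \<comment> \<open>With \<open>c\<close> coding \<open>(n, i)\<close>, this says that
    \<open>s\<close> is an enumeration step preceded by exactly \<open>i\<close> others.\<close>
  define P where "P s c \<longleftrightarrow> H (?l c) s \<and> (\<Sum>s'<s. of_bool (H (?l c) s')) = ?r c" for s c
  have decH: "decidable k (\<lambda>xs. H (a xs) (b xs))" if "computable k a" "computable k b" for k a b
    unfolding H_def
    by (rule comp_intros computable_recursive[OF assms(2)] that computable_comp[OF that(1)]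
        computable_comp[OF that(2)])+
  obtain d where d: "\<And>xs y. length xs = Suc 0 \<Longrightarrow> evals Map.empty d xs y \<longleftrightarrow>
      (\<exists>s. P s (hd xs)) \<and> y = ?l (LEAST s. P s (hd xs))"
    by (rule computable_search[of "Suc 0" "\<lambda>s xs. P s (hd xs)" "\<lambda>s xs. ?l s"])
      (unfold P_def, (rule comp_intros decH)+, blast)
  define \<theta> where "\<theta> c = (if \<exists>s. P s c then Some (?l (LEAST s. P s c)) else None)" for c
  show thesis
  proof (rule that)
    show "partial_recursive \<theta>"
      unfolding partial_recursive_def by (rule exI[of _ d]) (auto simp: d \<theta>_def)
    fix n z assume fin: "finite (W \<phi> (h n))" and "z \<in> W \<phi> (h n)"
    then obtain s where s: "H n s" "?l s = z" using W by blast
    define i where "i = card {s'. s' < s \<and> H n s'}"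
    have sum: "(\<Sum>s'<m. of_bool (H n s')) = card {s'. s' < m \<and> H n s'}" for m
      by (simp add: Int_def lessThan_def)
    have "P s (prod_encode (n, i))" using s(1) by (simp add: P_def i_def sum del: sum_of_bool_eq)
    moreover have "\<not> P s' (prod_encode (n, i))" if "s' < s" for s'
    proof
      assume P: "P s' (prod_encode (n, i))"
      \<comment> \<open>The inclusion is strict because \<open>s'\<close> is itself an enumeration
        step before \<open>s\<close>.\<close>
      then have "{s''. s'' < s' \<and> H n s''} \<subset> {s''. s'' < s \<and> H n s''}"
        using that unfolding P_def by auto
      then have "card {s''. s'' < s' \<and> H n s''} < i"
        unfolding i_def by (intro psubset_card_mono) auto
      with P show False by (simp add: P_def sum del: sum_of_bool_eq)
    qed
    ultimately have "(LEAST s. P s (prod_encode (n, i))) = s" "\<exists>s. P s (prod_encode (n, i))"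
      by (auto intro!: Least_equality simp: not_less[symmetric])
    then have "\<theta> (prod_encode (n, i)) = Some z" by (simp add: \<theta>_def s(2))
    moreover have "i < card (W \<phi> (h n))"
    proof -
      \<comment> \<open>Together with \<open>s\<close>, its \<open>i\<close> predecessors give
        \<open>i + 1\<close> distinct elements of the enumerated set.\<close>
      have "i < card (insert s {s'. s' < s \<and> H n s'})" by (simp add: i_def)
      also have "\<dots> = card (?l ` insert s {s'. s' < s \<and> H n s'})"
        using s(1) by (intro card_image[symmetric] inj_on_subset[OF inj]) auto
      also have "\<dots> \<le> card (W \<phi> (h n))"
        using s(1) W by (intro card_mono fin) auto
      finally show ?thesis .
    qed
    ultimately show "\<exists>i<card (W \<phi> (h n)). \<theta> (prod_encode (n, i)) = Some z" by blast
  qed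
qed

text \<open>Every element of the set is computed from a pair \<open>(n, i)\<close> with
  \<open>i < g n\<close>, which bounds its complexity. The reparametrisation depends on
  \<open>g\<close> alone, so one function serves all \<open>h\<close>.\<close>

lemma incompressible_avoids_small_sets:
  assumes "acceptable_numbering \<phi>" "universal_machine U"
    and f: "\<And>n. n \<le> plain_complexity U (str_of_nat (f n))"
    and "recursive g"
  obtains r where "recursive r"
    "\<And>h. recursive h \<Longrightarrow> (\<And>n. finite (W \<phi> (h n)) \<and> card (W \<phi> (h n)) < g n) \<Longrightarrow>
      \<forall>\<^sub>\<infinity>n. f (r n) \<notin> W \<phi> (h n)"
proof
  \<comment> \<open>The sum dominates each relevant code, and the added \<open>n\<close> eventually
    exceeds the constant belonging to \<open>h\<close>.\<close>
  let ?r = "\<lambda>n. Suc (n + (\<Sum>i<g n. prod_encode (n, i)))"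
  show "recursive ?r"
    unfolding recursive_iff_computable
    by (rule comp_intros computable_recursive[OF assms(4)])+
  fix h assume "recursive h" and h: "\<And>n. finite (W \<phi> (h n)) \<and> card (W \<phi> (h n)) < g n"
  then obtain \<theta> where \<theta>: "partial_recursive \<theta>"
    "\<And>n z. z \<in> W \<phi> (h n) \<Longrightarrow> \<exists>i<card (W \<phi> (h n)). \<theta> (prod_encode (n, i)) = Some z"
    using enumerate_W[OF assms(1)] by metis
  obtain c where c: "\<And>n v. \<theta> n = Some v \<Longrightarrow> plain_complexity U (str_of_nat v) \<le> n + c"
    using complexity_le_input[OF assms(2) \<theta>(1)] by blast
  have "f (?r n) \<notin> W \<phi> (h n)" if "c < n" for n
  proof
    assume "f (?r n) \<in> W \<phi> (h n)"
    then obtain i where i: "i < g n" "\<theta> (prod_encode (n, i)) = Some (f (?r n))"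
      using \<theta>(2) h by (meson less_trans)
    have "?r n \<le> prod_encode (n, i) + c" using f c[OF i(2)] le_trans by blast
    moreover have "prod_encode (n, i) \<le> (\<Sum>i<g n. prod_encode (n, i))"
      using i(1) by (intro member_le_sum) auto
    ultimately show False using that by simp
  qed
  then show "\<forall>\<^sub>\<infinity>n. f (?r n) \<notin> W \<phi> (h n)" unfolding MOST_nat by blast
qed

section \<open>From diagonal nonrecursiveness to complexity\<close>

lemma DNR_imp_complex_set:
  assumes "acceptable_numbering \<phi>" "universal_machine U"
    and "f \<le>wtt A" "DNR \<phi> f"
  shows "complex_set U A"
proof -
  obtain e u where u: "recursive u"
    and e: "\<And>x. evals (char_oracle A |` {..<u x}) e [x] (f x)"
    using assms(3) unfolding wtt_reducible_def by blast
  obtain d where d: "\<And>z w y. evals (list_oracle (str_of_nat w)) e [z] y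
      \<Longrightarrow> evals Map.empty d [z, w] y"
    using oracle_as_argument by blast
  obtain v where v: "\<And>n y. map_option nat_of_str (U (str_of_nat n)) = Some y
      \<longleftrightarrow> evals Map.empty v [n] y"
    using assms(2)
    unfolding universal_machine_def machine_def str_partial_recursive_def partial_recursive_def
    by blast
  \<comment> \<open>On \<open>z\<close> the function with index \<open>s p\<close> runs the
    reduction for input \<open>z\<close>, with the output of \<open>U\<close> on the program coded
    by \<open>p\<close> as oracle.\<close>
  obtain s where s: "recursive s" "\<And>p z y. \<phi> (s p) z = Some y \<longleftrightarrow>
      evals Map.empty (Comp d [Proj 1, Comp v [Proj 0]]) [p, z] y"
    using acceptable_numbering_smn[OF assms(1)] by blast
  have long: "y < u (s (nat_of_str p))" if "U p = Some (A \<restriction> y)" for p y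
  proof (rule ccontr)
    let ?n = "s (nat_of_str p)"
    assume "\<not> y < u ?n"
    then have "evals (list_oracle (A \<restriction> y)) e [?n] (f ?n)"
      unfolding list_oracle_initial_segment
      by (intro evals_mono[OF e] char_oracle_restrict_le) simp
    then have "evals Map.empty d [?n, nat_of_str (A \<restriction> y)] (f ?n)"
      using d[of "nat_of_str (A \<restriction> y)"] by simp
    moreover have "evals Map.empty v [nat_of_str p] (nat_of_str (A \<restriction> y))"
      using v[of "nat_of_str p" "nat_of_str (A \<restriction> y)"] that by simp
    ultimately have "\<phi> ?n ?n = Some (f ?n)"
      unfolding s(2) by (auto intro!: evals_Comp2 evals_Comp1 evals_Proj)
    with assms(4) show False by (simp add: DNR_def)
  qed
  \<comment> \<open>\<open>G k\<close> bounds \<open>u (s c)\<close> for the codes \<open>c\<close>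
    of all strings of length below \<open>k\<close>, hence the length of any initial segment of
    \<open>A\<close> that such a string outputs under \<open>U\<close>.\<close>
  define G where "G k = (\<Sum>c<2 ^ k. u (s c))" for k
  have G_mono: "G k \<le> G l" if "k \<le> l" for k l
    unfolding G_def using that by (intro sum_mono2) auto
  \<comment> \<open>Since \<open>G\<close> is monotone, the counted \<open>k\<close> form an initial
    segment: an approximate inverse of \<open>G\<close>. The cutoff \<open>k < y\<close> makes the
    count computable.\<close>
  define g :: "nat \<Rightarrow> nat" where "g y = (\<Sum>k<y. of_bool (G (Suc k) \<le> y))" for y
  have g: "g y = card {k. k < y \<and> G (Suc k) \<le> y}" for y
    by (simp add: g_def Int_def lessThan_def)
  have "recursive g"
    unfolding recursive_iff_computable g_def G_def
    by (rule comp_intros computable_recursive[OF u] computable_recursive[OF s(1)])+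
  moreover have "mono g"
    unfolding g by (intro monoI card_mono) auto
  moreover have "\<exists>y. k \<le> g y" for k
  proof -
    \<comment> \<open>With \<open>y\<close> at least \<open>k\<close> and \<open>G k\<close>, every
      \<open>j < k\<close> is counted.\<close>
    have "{..<k} \<subseteq> {j. j < max k (G k) \<and> G (Suc j) \<le> max k (G k)}"
      using G_mono by (fastforce simp: Suc_le_eq le_max_iff_disj less_max_iff_disj)
    then have "card {..<k} \<le> g (max k (G k))" unfolding g by (intro card_mono) auto
    then show ?thesis by auto
  qed
  moreover have "g y \<le> plain_complexity U (A \<restriction> y)" for y
  proof -
    define m where "m = plain_complexity U (A \<restriction> y)"
    have "\<exists>p. length p = m \<and> U p = Some (A \<restriction> y)"
      unfolding m_def plain_complexity_def
      by (rule LeastI_ex) (use universal_machine_surj[OF assms(2)] in auto)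
    then obtain p where p: "length p = m" "U p = Some (A \<restriction> y)" by blast
    have "nat_of_str p < 2 ^ Suc m" using nat_of_str_bounds[of p] p(1) by simp
    then have "u (s (nat_of_str p)) \<le> G (Suc m)"
      unfolding G_def by (intro member_le_sum) auto
    with long[OF p(2)] have "y < G (Suc m)" by simp
    \<comment> \<open>For a shortest program of length \<open>m\<close>, a counted
      \<open>k \<ge> m\<close> would give \<open>G (Suc m) \<le> y\<close>.\<close>
    then have "{k. k < y \<and> G (Suc k) \<le> y} \<subseteq> {..<m}"
      using G_mono by (smt (verit) Suc_le_mono lessThan_iff linorder_not_le mem_Collect_eq
          order_trans subsetI)
    then have "card {k. k < y \<and> G (Suc k) \<le> y} \<le> card {..<m}" by (intro card_mono) auto
    then show ?thesis unfolding g m_def by simp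
  qed
  ultimately show ?thesis unfolding complex_set_def by blast
qed

text \<open>Both reducibilities are treated at once by building a truth-table reduction and
  weakening it where necessary; \<open>Q\<close> stands for the property required in the chosen
  condition.\<close>

lemma complex_set_imp_reducible:
  assumes "complex_set U A" "red \<in> {(\<le>wtt), (\<le>tt)}"
    and Q: "\<And>f. (\<And>n. n \<le> plain_complexity U (str_of_nat (f n))) \<Longrightarrow>
      \<exists>r. recursive r \<and> Q (\<lambda>x. f (r x))"
  shows "\<exists>f. red f A \<and> Q f"
proof -
  obtain f where f: "f \<le>tt A" "\<And>n. n \<le> plain_complexity U (str_of_nat (f n))"
    using complex_set_imp_incompressible[OF assms(1)] by blast
  obtain r where r: "recursive r" "Q (\<lambda>x. f (r x))" using Q f(2) by blast
  have "(\<lambda>x. f (r x)) \<le>tt A" using f(1) r(1) by (rule tt_recursive_comp)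
  with r(2) assms(2) tt_imp_wtt show ?thesis by blast
qed

lemma reducible_imp_complex_set:
  assumes "acceptable_numbering \<phi>" "universal_machine U"
    and "red f A" "red \<in> {(\<le>wtt), (\<le>tt)}" "\<exists>r. recursive r \<and> DNR \<phi> (\<lambda>x. f (r x))"
  shows "complex_set U A"
proof -
  have "f \<le>wtt A" using assms(3,4) tt_imp_wtt by blast
  with assms(5) DNR_imp_complex_set[OF assms(1,2)] wtt_recursive_comp show ?thesis by blast
qed

lemma recursive_id: "recursive (\<lambda>x. x)"
  unfolding recursive_iff_computable by (rule comp_intros)+

section \<open>Equivalence of the conditions for both reducibilities\<close>

theorem theorem2p6:
  fixes \<phi> :: "nat \<Rightarrow> nat \<rightharpoonup> nat"
    and U :: "bool list \<rightharpoonup> bool list"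
    and A :: "nat set"
  assumes "acceptable_numbering \<phi>"
    and "universal_machine U"
  shows "\<forall>red \<in> {(\<le>wtt), (\<le>tt)}.
      ((\<exists>f\<^sub>1. red f\<^sub>1 A \<and> SDNR \<phi> f\<^sub>1) \<longleftrightarrow> complex_set U A) \<and>
      ((\<forall>g. recursive g \<longrightarrow>
          (\<exists>f\<^sub>2. red f\<^sub>2 A \<and>
            (\<forall>h. recursive h \<and> (\<forall>n. finite (W \<phi> (h n)) \<and> card (W \<phi> (h n)) < g n) \<longrightarrow>
              (\<forall>\<^sub>\<infinity>n. f\<^sub>2 n \<notin> W \<phi> (h n))))) \<longleftrightarrow> complex_set U A) \<and>
      ((\<exists>f\<^sub>3. red f\<^sub>3 A \<and>
          (\<forall>V. str_partial_recursive V \<longrightarrow>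
            (\<forall>\<^sub>\<infinity>n. f\<^sub>3 n \<notin> {v. \<exists>p. length p < n \<and> V p = Some v}))) \<longleftrightarrow> complex_set U A) \<and>
      ((\<exists>f\<^sub>4. red f\<^sub>4 A \<and> (\<forall>n. n \<le> plain_complexity U (str_of_nat (f\<^sub>4 n)))) \<longleftrightarrow> complex_set U A) \<and>
      ((\<exists>f\<^sub>5. red f\<^sub>5 A \<and> DNR \<phi> f\<^sub>5) \<longleftrightarrow> complex_set U A)"
proof (intro ballI conjI iffI)
  fix red assume red: "red \<in> {(\<le>wtt), (\<le>tt)}"
  note to_complex = reducible_imp_complex_set[OF assms _ red]
  note from_complex = complex_set_imp_reducible[OF _ red]
  have DNR: "complex_set U A" if "red f A" "DNR \<phi> f" for f
    by (rule to_complex[OF that(1)], rule exI[of _ "\<lambda>x. x"]) (simp add: recursive_id that(2))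
  show "complex_set U A" if "\<exists>f. red f A \<and> SDNR \<phi> f"
    using that DNR SDNR_imp_DNR by blast
  show "complex_set U A" if "\<exists>f. red f A \<and> DNR \<phi> f"
    using that DNR by blast
  show SDNR: "\<exists>f. red f A \<and> SDNR \<phi> f" if "complex_set U A"
    using that
  proof (rule from_complex)
    fix f assume "\<And>n. n \<le> plain_complexity U (str_of_nat (f n))"
    then obtain r where "recursive r" "SDNR \<phi> (\<lambda>x. f (r x))"
      using incompressible_imp_SDNR[OF assms] by blast
    then show "\<exists>r. recursive r \<and> SDNR \<phi> (\<lambda>x. f (r x))" by blast
  qed
  show "\<exists>f. red f A \<and> DNR \<phi> f" if "complex_set U A"
    using SDNR[OF that] SDNR_imp_DNR by blast
  show "\<exists>f. red f A \<and> (\<forall>n. n \<le> plain_complexity U (str_of_nat (f n)))" if "complex_set U A"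
    using that by (rule from_complex) (rule exI[of _ "\<lambda>x. x"], simp add: recursive_id)
  show "complex_set U A"
    if ex: "\<exists>f. red f A \<and> (\<forall>n. n \<le> plain_complexity U (str_of_nat (f n)))"
  proof -
    obtain f where f: "red f A" "\<And>n. n \<le> plain_complexity U (str_of_nat (f n))"
      using ex by blast
    obtain r where "recursive r" "SDNR \<phi> (\<lambda>x. f (r x))"
      using incompressible_imp_SDNR[OF assms f(2)] by blast
    then show ?thesis using to_complex[OF f(1)] SDNR_imp_DNR by blast
  qed
  show "\<exists>f. red f A \<and> (\<forall>V. str_partial_recursive V \<longrightarrow>
      (\<forall>\<^sub>\<infinity>n. f n \<notin> {v. \<exists>p. length p < n \<and> V p = Some v}))" if "complex_set U A"
    using that
  proof (rule from_complex)
    fix f assume "\<And>n. n \<le> plain_complexity U (str_of_nat (f n))"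
    then have "\<forall>V. str_partial_recursive V \<longrightarrow>
        (\<forall>\<^sub>\<infinity>n. f (2 * n) \<notin> {v. \<exists>p. length p < n \<and> V p = Some v})"
      using incompressible_avoids_short_programs[OF assms(2)] by blast
    moreover have "recursive (\<lambda>n. 2 * n)"
      unfolding recursive_iff_computable by (rule comp_intros)+
    ultimately show "\<exists>r. recursive r \<and> (\<forall>V. str_partial_recursive V \<longrightarrow>
        (\<forall>\<^sub>\<infinity>n. f (r n) \<notin> {v. \<exists>p. length p < n \<and> V p = Some v}))"
      by (intro exI[of _ "\<lambda>n. 2 * n"]) blast
  qed
  show "complex_set U A" if ex: "\<exists>f. red f A \<and> (\<forall>V. str_partial_recursive V \<longrightarrow>
      (\<forall>\<^sub>\<infinity>n. f n \<notin> {v. \<exists>p. length p < n \<and> V p = Some v}))"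
  proof -
    obtain f where f: "red f A" "\<And>V. str_partial_recursive V \<Longrightarrow>
        \<forall>\<^sub>\<infinity>n. f n \<notin> {v. \<exists>p. length p < n \<and> V p = Some v}"
      using ex by blast
    obtain r where "recursive r" "DNR \<phi> (\<lambda>x. f (r x))"
      using avoids_short_programs_imp_DNR[OF assms(1) f(2)] by blast
    then show ?thesis using to_complex[OF f(1)] by blast
  qed
  let ?avoids = "\<lambda>f g. \<forall>h. recursive h \<and> (\<forall>n. finite (W \<phi> (h n)) \<and> card (W \<phi> (h n)) < g n) \<longrightarrow>
      (\<forall>\<^sub>\<infinity>n. f n \<notin> W \<phi> (h n))"
  show "\<forall>g. recursive g \<longrightarrow> (\<exists>f. red f A \<and> ?avoids f g)" if "complex_set U A"
  proof (intro allI impI)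
    fix g assume g: "recursive g"
    show "\<exists>f. red f A \<and> ?avoids f g"
      using that
    proof (rule from_complex)
      fix f assume f: "\<And>n. n \<le> plain_complexity U (str_of_nat (f n))"
      show "\<exists>r. recursive r \<and> ?avoids (\<lambda>x. f (r x)) g"
      proof (rule incompressible_avoids_small_sets[OF assms f g])
        fix r
        assume "recursive r"
          "\<And>h. recursive h \<Longrightarrow> (\<And>n. finite (W \<phi> (h n)) \<and> card (W \<phi> (h n)) < g n) \<Longrightarrow>
            \<forall>\<^sub>\<infinity>n. f (r n) \<notin> W \<phi> (h n)"
        then show ?thesis by (intro exI[of _ r]) simp
      qed
    qed
  qed
  show "complex_set U A" if all: "\<forall>g. recursive g \<longrightarrow> (\<exists>f. red f A \<and> ?avoids f g)"
  proof -
    \<comment> \<open>The bound 2 admits sets with at most one element, enough to encode the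
      diagonal values.\<close>
    have "recursive (\<lambda>_. 2)"
      unfolding recursive_iff_computable by (rule comp_intros)
    with all obtain f where f: "red f A" "?avoids f (\<lambda>_. 2)" by blast
    have "\<forall>\<^sub>\<infinity>n. f n \<notin> W \<phi> (h n)"
      if "recursive h" "\<And>n. finite (W \<phi> (h n)) \<and> card (W \<phi> (h n)) < 2" for h
      using f(2) that by simp
    then obtain r where "recursive r" "DNR \<phi> (\<lambda>x. f (r x))"
      by (rule avoids_small_sets_imp_DNR[OF assms(1)])
    then show ?thesis using to_complex[OF f(1)] by blast
  qed
qed

end
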